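(* Let $n\geq 2$, let $d=\binom{n+1}{2}-1$, and let $B_1,\ldots,B_d$ be a basis for $I_n^\perp$, the subspace of real symmetric $n\times n$ matrices with trace zero. For $X\in\mathcal{S}^n$, let $\mathcal{B}(X)$ be the $d\times d$ symmetric matrix with $(i,j)$ entry $\operatorname{tr}(B_iXB_j)$. Then there is a positive constant $c$ (depending on the choice of basis) such that: 1. $q(X) = \prod_{1\leq i<j\leq n} (\lambda_i(X)+\lambda_j(X))$ is hyperbolic with respect to $I_n$; 2. the hyperbolicity cone associated with $q$ satisfies $$\Lambda_{+}(q,I_n) = \{X\in \mathcal{S}^n : \lambda_i(X) + \lambda_j(X) \geq 0 \text{ for all } 1\leq i<j\leq n\} \supseteq \mathcal{S}_+^{n,(1)};$$ 3. $q(X)E_{n-1}(X)$ has a definite determinantal representation as $$c\,q(X)E_{n-1}(X) = \det(\mathcal{B}(X)) \quad\text{for all } X\in\mathcal{S}^n.$$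
   Context: $\mathcal{S}^n$ denotes the space of real symmetric $n\times n$ matrices and $I_n$ the identity matrix. For $X\in\mathcal{S}^n$, $\lambda_1(X),\ldots,\lambda_n(X)$ denote the eigenvalues of $X$ (with multiplicity), ordered so that $|\lambda_1(X)|\ge\cdots\ge|\lambda_n(X)|$. Since $q$ is a symmetric polynomial in the eigenvalues of $X$, it is a polynomial in the entries of $X$. A homogeneous real polynomial $p$ on a finite-dimensional real vector space $V$ is hyperbolic with respect to $e\in V$ if $p(e)\neq 0$ and for all $x\in V$ the univariate polynomial $t\mapsto p(x-te)$ has only real roots. Its closed hyperbolicity cone is $\Lambda_+(p,e)=\{x\in V : \text{all roots of } t\mapsto p(x-te) \text{ are non-negative}\}$. $E_{n-1}(X)$ denotes the elementary symmetric polynomial of degree $n-1$ in the eigenvalues of $X$ (equivalently, the coefficient of $t$ in $\det(X+tI_n)$); it is hyperbolic with respect to $I_n$, and $\mathcal{S}_+^{n,(1)}=\Lambda_+(E_{n-1},I_n)$. A definite determinantal representation of a polynomial is an expression of it (here up to the positive constant $c$) as $\det(\mathcal{A}(x))$, where $\mathcal{A}(x)$ is a symmetric matrix depending linearly on $x$ and $\mathcal{A}(e)$ is positive definite for some $e$. *)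

theory Defs
  imports "HOL-Analysis.Analysis" "HOL-Computational_Algebra.Computational_Algebra"
begin

text \<open>
  Hyperbolic polynomials on a subspace \<open>V\<close> of a Euclidean space. The values of \<open>p\<close> outside
  \<open>V\<close> are irrelevant; \<open>p\<close> is a polynomial on \<open>V\<close> when it agrees there with a polynomial
  function on the ambient space.
\<close>

definition homogeneous_polynomial_on :: "'a::euclidean_space set \<Rightarrow> ('a \<Rightarrow> real) \<Rightarrow> bool" where
  "homogeneous_polynomial_on V p \<longleftrightarrow>
     (\<exists>f. real_polynomial_function f \<and> (\<forall>x\<in>V. f x = p x)) \<and>
     (\<exists>k::nat. \<forall>x\<in>V. \<forall>s. p (s *\<^sub>R x) = s ^ k * p x)"

text \<open>The univariate polynomial in \<open>t\<close> given by \<open>p (x - t e)\<close>; meaningful when one exists.\<close>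

definition line_poly :: "('a::euclidean_space \<Rightarrow> real) \<Rightarrow> 'a \<Rightarrow> 'a \<Rightarrow> real poly" where
  "line_poly p e x = (THE P. \<forall>t. poly P t = p (x - t *\<^sub>R e))"

lemma line_poly_eqI:
  assumes "\<And>t. poly P t = p (x - t *\<^sub>R e)"
  shows "line_poly p e x = P"
  unfolding line_poly_def
proof (rule the_equality)
  fix Q assume "\<forall>t. poly Q t = p (x - t *\<^sub>R e)"
  with assms have "poly Q = poly P" by auto
  then show "Q = P" by (simp add: poly_eq_poly_eq_iff)
qed (use assms in blast)

definition hyperbolic_on :: "'a::euclidean_space set \<Rightarrow> ('a \<Rightarrow> real) \<Rightarrow> 'a \<Rightarrow> bool" where
  "hyperbolic_on V p e \<longleftrightarrow>
     homogeneous_polynomial_on V p \<and> e \<in> V \<and> p e \<noteq> 0 \<and>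
     (\<forall>x\<in>V. \<forall>z::complex. poly (map_poly complex_of_real (line_poly p e x)) z = 0 \<longrightarrow> z \<in> \<real>)"

definition hyperbolicity_cone :: "'a::euclidean_space set \<Rightarrow> ('a \<Rightarrow> real) \<Rightarrow> 'a \<Rightarrow> 'a set" where
  "hyperbolicity_cone V p e =
     {x \<in> V. \<forall>z::complex. poly (map_poly complex_of_real (line_poly p e x)) z = 0
                \<longrightarrow> z \<in> \<real>\<^sub>\<ge>\<^sub>0}"

definition sym_matrices :: "(real^'n^'n) set" where
  "sym_matrices = {X. transpose X = X}"

definition trace_free_sym_matrices :: "(real^'n^'n) set" where
  "trace_free_sym_matrices = {X \<in> sym_matrices. trace X = 0}"

definition indexed_basis_of :: "('d \<Rightarrow> 'a::real_vector) \<Rightarrow> 'a set \<Rightarrow> bool" where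
  "indexed_basis_of B V \<longleftrightarrow> inj B \<and> independent (range B) \<and> span (range B) = V"

definition positive_definite :: "real^'d^'d \<Rightarrow> bool" where
  "positive_definite M \<longleftrightarrow> M \<in> sym_matrices \<and> (\<forall>v. v \<noteq> 0 \<longrightarrow> v \<bullet> (M *v v) > 0)"

definition definite_determinantal_representation_on ::
    "'a::euclidean_space set \<Rightarrow> ('a \<Rightarrow> real) \<Rightarrow> ('a \<Rightarrow> real^'d^'d) \<Rightarrow> bool" where
  "definite_determinantal_representation_on V p \<A> \<longleftrightarrow>
     (\<forall>x\<in>V. \<forall>y\<in>V. \<forall>a b. \<A> (a *\<^sub>R x + b *\<^sub>R y) = a *\<^sub>R \<A> x + b *\<^sub>R \<A> y) \<and>
     (\<forall>x\<in>V. \<A> x \<in> sym_matrices) \<and>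
     (\<exists>e\<in>V. positive_definite (\<A> e)) \<and>
     (\<forall>x\<in>V. p x = det (\<A> x))"

definition charpoly :: "real^'n^'n \<Rightarrow> real poly" where
  "charpoly X = det (mat [:0, 1:] - (\<chi> i j. [:X $ i $ j:]))"

text \<open>
  The real eigenvalues with algebraic multiplicity, by decreasing absolute value (for a symmetric
  matrix, all \<open>n\<close> of them). Between \<open>a\<close> and \<open>-a\<close> the negative one comes first, an arbitrary choice.
\<close>

definition eigenvalue_list :: "real^'n^'n \<Rightarrow> real list" where
  "eigenvalue_list X =
     sort_key (\<lambda>a. - \<bar>a\<bar>) (sorted_list_of_multiset (proots (charpoly X)))"

text \<open>Indexed from 1.\<close>

definition eigval :: "real^'n^'n \<Rightarrow> nat \<Rightarrow> real" where
  "eigval X i = eigenvalue_list X ! (i - 1)"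

definition elem_sym :: "nat \<Rightarrow> real^'n^'n \<Rightarrow> real" where
  "elem_sym k X = (\<Sum>A | A \<subseteq> {1..CARD('n)} \<and> card A = k. \<Prod>i\<in>A. eigval X i)"

definition q_poly :: "real^'n^'n \<Rightarrow> real" where
  "q_poly X = (\<Prod>(i, j) | 1 \<le> i \<and> i < j \<and> j \<le> CARD('n). eigval X i + eigval X j)"

definition psd_derivative_cone :: "(real^'n^'n) set" where
  "psd_derivative_cone = hyperbolicity_cone sym_matrices (elem_sym (CARD('n) - 1)) (mat 1)"

definition B_matrix :: "('d \<Rightarrow> real^'n^'n) \<Rightarrow> real^'n^'n \<Rightarrow> real^'d^'d" where
  "B_matrix B X = (\<chi> i j. trace (B i ** X ** B j))"

end

theory Submission
  imports Defs
begin

text \<open>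
  Diagonalize \<open>X = Q D Q\<^sup>T\<close>. Then \<open>q\<close> is the product of \<open>l\<^sub>i + l\<^sub>j\<close> over all two-element sets of
  eigenvalues, and its roots along \<open>X - t I\<close> are \<open>(l\<^sub>i + l\<^sub>j) / 2\<close>, which gives hyperbolicity and the
  cone. It is a polynomial because it is the determinant of \<open>A \<mapsto> X A + A X\<close> on skew-symmetric
  matrices. Up to sign, \<open>E\<^sub>n\<^sub>-\<^sub>1\<close> along \<open>X - t I\<close> is the derivative of the characteristic polynomial; if
  \<open>l\<^sub>i + l\<^sub>j < 0\<close> for some pair, it has a negative root.

  For the determinant, \<open>\<B>(X)\<close> is the Gram matrix of the form \<open>(A, B) \<mapsto> tr (A X B)\<close>. In an orthonormal
  basis of the trace-free symmetric matrices adapted to \<open>Q\<close> the form is diagonal, with entries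
  \<open>(l\<^sub>i + l\<^sub>j) / 2\<close> from the off-diagonal matrix units and, from the diagonal matrices, the eigenvalues of
  the compression of \<open>D\<close> to the complement of \<open>(1, \<dots>, 1)\<close>, whose product is \<open>E\<^sub>n\<^sub>-\<^sub>1 / n\<close>. A change
  of orthonormal basis multiplies the determinant by \<open>\<plusminus>1\<close> twice, so the constant is the same for all \<open>X\<close>.
\<close>

(* Otherwise $ is ambiguous between vectors and power series, with exponentially many parses. *)
no_notation fps_nth (infixl \<open>$\<close> 75)

section \<open>Spectral theorem\<close>

text \<open>The quadratic form \<open>x \<bullet> f x\<close> attains its maximum on the compact
  unit sphere of \<open>S\<close>, and a maximizer is an eigenvector: otherwise moving along the
  residual would increase the Rayleigh quotient.\<close>

lemma selfadjoint_maximizer_eigenvector: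
  fixes f :: "'a::euclidean_space \<Rightarrow> 'a"
  assumes f: "linear f" and S: "subspace S" and inv: "f ` S \<subseteq> S"
    and sa: "\<And>x y. x \<in> S \<Longrightarrow> y \<in> S \<Longrightarrow> f x \<bullet> y = x \<bullet> f y"
    and ne: "S \<noteq> {0}"
  obtains v \<mu> where "v \<in> S" "norm v = 1" "f v = \<mu> *\<^sub>R v"
proof -
  let ?T = "S \<inter> sphere 0 1"
  obtain x where x: "x \<in> S" "x \<noteq> 0"
    using ne subspace_0[OF S] by blast
  then have "(1 / norm x) *\<^sub>R x \<in> ?T"
    using subspace_scale[OF S] by simp
  then have Tne: "?T \<noteq> {}" by blast
  have cT: "compact ?T"
    using closed_Int_compact[OF closed_subspace[OF S] compact_sphere] .
  have "continuous_on ?T (\<lambda>x. x \<bullet> f x)"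
    using linear_continuous_on[OF f[unfolded linear_conv_bounded_linear]]
    by (intro continuous_intros)
  from continuous_attains_sup[OF cT Tne this]
  obtain v where v: "v \<in> S" "norm v = 1" and max: "\<And>y. y \<in> ?T \<Longrightarrow> y \<bullet> f y \<le> v \<bullet> f v"
    by auto
  define \<mu> where "\<mu> = v \<bullet> f v"
  have le: "w \<bullet> f w \<le> \<mu> * (w \<bullet> w)" if w: "w \<in> S" for w
  proof (cases "w = 0")
    case False
    let ?y = "(1 / norm w) *\<^sub>R w"
    have "?y \<in> ?T" using False w subspace_scale[OF S] by simp
    from max[OF this] have "(w \<bullet> f w) / (norm w)\<^sup>2 \<le> \<mu>"
      by (simp add: \<mu>_def linear_cmul[OF f] power2_eq_square)
    then show ?thesis using False
      by (simp add: divide_le_eq power2_norm_eq_inner)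
  qed (simp add: linear_0[OF f])
  \<comment> \<open>The residual serves as its own perturbation direction: at
    \<open>v + t *\<^sub>R w\<close> the nonnegative gap
    \<open>\<mu> * (x \<bullet> x) - x \<bullet> f x\<close> equals
    \<open>2 * t * (w \<bullet> w) + t\<^sup>2 * g\<close>.\<close>
  define w where "w = \<mu> *\<^sub>R v - f v"
  have w: "w \<in> S"
    unfolding w_def using v inv by (auto intro!: subspace_diff subspace_scale S)
  have vv: "v \<bullet> v = 1" using v by (simp add: dot_square_norm)
  define g where "g = \<mu> * (w \<bullet> w) - w \<bullet> f w"
  have g0: "g \<ge> 0" using le[OF w] by (simp add: g_def)
  have quad: "0 \<le> 2 * t * (w \<bullet> w) + t\<^sup>2 * g" for t
  proof -
    have "v + t *\<^sub>R w \<in> S" using v w S by (simp add: subspace_add subspace_scale)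
    from le[OF this]
    have "\<mu> + t * (v \<bullet> f w) + t * (w \<bullet> f v) + t\<^sup>2 * (w \<bullet> f w)
       \<le> \<mu> * (1 + 2 * t * (v \<bullet> w) + t\<^sup>2 * (w \<bullet> w))"
      using vv by (simp add: linear_add[OF f] linear_cmul[OF f] inner_add_left inner_add_right
          \<mu>_def power2_eq_square algebra_simps inner_commute)
    moreover have "v \<bullet> f w = w \<bullet> f v" using sa[OF v(1) w] by (simp add: inner_commute)
    moreover have "\<mu> * (1 + 2 * t * (v \<bullet> w) + t\<^sup>2 * (w \<bullet> w))
        = \<mu> + 2 * t * (\<mu> * (v \<bullet> w)) + t\<^sup>2 * (\<mu> * (w \<bullet> w))"
      by (simp add: algebra_simps)
    moreover have "\<mu> * (v \<bullet> w) = w \<bullet> w + w \<bullet> f v"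
      by (simp add: w_def inner_diff_left inner_diff_right inner_commute algebra_simps)
    ultimately show ?thesis by (simp add: g_def algebra_simps)
  qed
  have "w \<bullet> w = 0"
  proof (rule ccontr)
    assume "w \<bullet> w \<noteq> 0"
    then have p: "w \<bullet> w > 0" by simp
    \<comment> \<open>A negative \<open>t\<close> this small lets the linear term dominate the
      quadratic one; dividing by \<open>g + 1\<close> instead of \<open>g\<close> covers
      \<open>g = 0\<close>.\<close>
    let ?t = "- (w \<bullet> w) / (g + 1)"
    have "2 * ?t * (w \<bullet> w) + ?t\<^sup>2 * g = (w \<bullet> w)\<^sup>2 / (g+1) * (g / (g+1) - 2)"
      using g0 by (simp add: power2_eq_square divide_simps) (simp add: algebra_simps)
    moreover have "g / (g+1) - 2 < 0" using g0 by (simp add: field_simps)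
    moreover have "(w \<bullet> w)\<^sup>2 / (g+1) > 0" using p g0 by simp
    ultimately show False using quad[of ?t] mult_pos_neg by (metis not_le)
  qed
  then have "f v = \<mu> *\<^sub>R v" by (simp add: w_def)
  with v that show ?thesis by blast
qed

text \<open>Split off one eigenvector; self-adjointness makes its orthogonal complement in
  \<open>S\<close> invariant again. The form relative to a subspace serves the induction and also
  the later compression to a hyperplane.\<close>

lemma selfadjoint_orthonormal_eigenbasis:
  fixes f :: "'a::euclidean_space \<Rightarrow> 'a"
  assumes f: "linear f" and S: "subspace S" and inv: "f ` S \<subseteq> S"
    and sa: "\<And>x y. x \<in> S \<Longrightarrow> y \<in> S \<Longrightarrow> f x \<bullet> y = x \<bullet> f y"
  shows "\<exists>E. E \<subseteq> S \<and> finite E \<and> card E = dim S \<and> pairwise orthogonal E \<and>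
    (\<forall>v\<in>E. norm v = 1 \<and> (\<exists>\<mu>. f v = \<mu> *\<^sub>R v))"
  using S inv sa
proof (induction "dim S" arbitrary: S)
  case 0
  then show ?case by (intro exI[of _ "{}"]) auto
next
  case (Suc k)
  have "S \<noteq> {0}" using Suc.hyps(2) by (metis dim_eq_0 nat.distinct(1) order_refl)
  then obtain v \<mu> where v: "v \<in> S" "norm v = 1" "f v = \<mu> *\<^sub>R v"
    using selfadjoint_maximizer_eigenvector[OF f Suc.prems] by blast
  define T where "T = {x \<in> S. orthogonal v x}"
  have T: "subspace T"
    unfolding T_def using Suc.prems(1)
    by (auto simp: subspace_def orthogonal_def inner_add_right)
  have TS: "T \<subseteq> S" by (auto simp: T_def)
  have "dim {y \<in> S. \<forall>x \<in> span {v}. orthogonal x y} + dim (span {v}) = dim S"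
    by (rule dim_subspace_orthogonal_to_vectors)
       (use v Suc.prems(1) in \<open>auto simp: span_minimal\<close>)
  moreover have "{y \<in> S. \<forall>x \<in> span {v}. orthogonal x y} = T"
    by (auto simp: T_def span_singleton orthogonal_def span_base)
  moreover have "dim (span {v}) = 1" using v by (simp add: dim_singleton) auto
  ultimately have dT: "dim S = Suc (dim T)" by simp
  have invT: "f ` T \<subseteq> T"
  proof
    fix y assume "y \<in> f ` T"
    then obtain x where x: "x \<in> S" "v \<bullet> x = 0" "y = f x" by (auto simp: T_def orthogonal_def)
    have "v \<bullet> f x = f v \<bullet> x" using Suc.prems(3)[OF v(1) x(1)] by simp
    then show "y \<in> T" using x v Suc.prems(2) by (auto simp: T_def orthogonal_def)
  qed
  obtain E where E: "E \<subseteq> T" "finite E" "card E = dim T" "pairwise orthogonal E"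
    "\<forall>v\<in>E. norm v = 1 \<and> (\<exists>\<mu>. f v = \<mu> *\<^sub>R v)"
    using Suc.hyps(1)[of T] T invT TS Suc.prems(3) dT Suc.hyps(2) by (metis nat.inject subset_eq)
  have "v \<notin> E" using E(1) v by (auto simp: T_def orthogonal_def)
  moreover have "pairwise orthogonal (insert v E)"
    using E(1,4) by (auto simp: pairwise_insert T_def orthogonal_commute)
  ultimately show ?case
    using E TS v dT by (intro exI[of _ "insert v E"]) auto
qed

section \<open>Diagonalization and the list of eigenvalues\<close>

definition diag_mat :: "('n \<Rightarrow> 'a::zero) \<Rightarrow> 'a^'n^'n" where
  "diag_mat l = (\<chi> i j. if i = j then l i else 0)"

lemma diag_mat_nth [simp]: "diag_mat l $ i $ j = (if i = j then l i else 0)"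
  by (simp add: diag_mat_def)

lemma if_zero_mult:
  fixes a b :: "'a::semiring_1"
  shows "(if P then a else 0) * b = (if P then a * b else 0)"
    "b * (if P then a else 0) = (if P then b * a else 0)"
  by auto

lemma matrix_mult_diag_mat_nth:
  fixes A :: "'a::comm_semiring_1^'n^'m"
  shows "(A ** diag_mat l) $ i $ j = A $ i $ j * l j"
  by (simp add: matrix_matrix_mult_def if_zero_mult cong: if_cong)

lemma matrix_diff_distrib:
  fixes A :: "'a::ring_1^'n^'m" and C :: "'a^'p^'n"
  shows "(A - B) ** C = A ** C - B ** C" "A ** (C - D) = A ** C - A ** D"
  by (simp_all add: vec_eq_iff matrix_matrix_mult_def sum_subtractf left_diff_distrib right_diff_distrib)

lemma orthogonal_matrix_entries:
  fixes Q :: "real^'n^'n"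
  assumes "orthogonal_matrix Q"
  shows "(\<Sum>k\<in>UNIV. Q $ i $ k * Q $ j $ k) = (if i = j then 1 else 0)"
    and "(\<Sum>k\<in>UNIV. Q $ k $ i * Q $ k $ j) = (if i = j then 1 else 0)"
proof -
  have "(Q ** transpose Q) $ i $ j = mat 1 $ i $ j" "(transpose Q ** Q) $ i $ j = mat 1 $ i $ j"
    using assms by (simp_all add: orthogonal_matrix_def)
  then show "(\<Sum>k\<in>UNIV. Q $ i $ k * Q $ j $ k) = (if i = j then 1 else 0)"
    "(\<Sum>k\<in>UNIV. Q $ k $ i * Q $ k $ j) = (if i = j then 1 else 0)"
    by (simp_all add: matrix_matrix_mult_def transpose_def mat_def)
qed

lemma sym_matrix_selfadjoint:
  assumes "X \<in> sym_matrices"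
  shows "(X *v x) \<bullet> y = x \<bullet> (X *v y)"
  using assms dot_lmul_matrix[of x X y] transpose_matrix_vector[of X x] by (simp add: sym_matrices_def)

text \<open>The columns of \<open>Q\<close> are an orthonormal eigenbasis, so
  \<open>X ** Q = Q ** diag_mat l\<close>. The values \<open>l\<close> are indexed by the type
  \<open>'n\<close> and carry no order.\<close>

lemma sym_matrix_diagonalization:
  fixes X :: "real^'n^'n"
  assumes "X \<in> sym_matrices"
  obtains Q l where "orthogonal_matrix Q" "X = Q ** diag_mat l ** transpose Q"
proof -
  obtain E where E: "finite E" "card E = CARD('n)" "pairwise orthogonal E"
    "\<And>v. v \<in> E \<Longrightarrow> norm v = 1" "\<And>v. v \<in> E \<Longrightarrow> \<exists>\<mu>. X *v v = \<mu> *\<^sub>R v"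
    using selfadjoint_orthonormal_eigenbasis[OF matrix_vector_mul_linear subspace_UNIV, of X]
      sym_matrix_selfadjoint[OF assms] by (auto simp: dim_UNIV)
  obtain u where u: "bij_betw u (UNIV :: 'n set) E"
    using E(1,2) finite_same_card_bij[of "UNIV :: 'n set" E] by auto
  have uE: "u j \<in> E" for j using u by (auto simp: bij_betw_def)
  have uo: "u i \<bullet> u j = 0" if "i \<noteq> j" for i j
  proof -
    have "u i \<noteq> u j" using u that by (auto simp: bij_betw_def inj_on_def)
    then show ?thesis using E(3) uE by (auto simp: pairwise_def orthogonal_def)
  qed
  obtain l where l: "\<And>j. X *v u j = l j *\<^sub>R u j" using E(5)[OF uE] by metis
  define Q where "Q = (\<chi> i j. u j $ i)"
  have col: "column j Q = u j" for j by (simp add: Q_def column_def vec_eq_iff)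
  have Q: "orthogonal_matrix Q"
    unfolding orthogonal_matrix_orthonormal_columns col
    using uo E(4)[OF uE] by (auto simp: orthogonal_def)
  have "X ** Q = Q ** diag_mat l"
  proof (simp add: vec_eq_iff matrix_mult_diag_mat_nth, intro allI)
    fix i j
    have "(X ** Q) $ i $ j = (X *v u j) $ i"
      by (simp add: matrix_matrix_mult_def matrix_vector_mult_def Q_def)
    then show "(X ** Q) $ i $ j = Q $ i $ j * l j" by (simp add: l Q_def)
  qed
  then have "X ** (Q ** transpose Q) = Q ** diag_mat l ** transpose Q"
    by (simp add: matrix_mul_assoc)
  then have "X = Q ** diag_mat l ** transpose Q"
    using Q by (simp add: orthogonal_matrix_def)
  with Q that show ?thesis by blast
qed

lemma diagonalization_sym: "Q ** diag_mat l ** transpose Q \<in> sym_matrices"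
proof -
  have "transpose (diag_mat l) = diag_mat l" by (simp add: vec_eq_iff transpose_def)
  then show ?thesis by (simp add: sym_matrices_def matrix_transpose_mul matrix_mul_assoc)
qed

text \<open>The usual similarity argument, carried out over the polynomial ring: \<open>cm\<close>
  embeds real matrices multiplicatively as constant ones, and the scalar matrix
  \<open>mat [:0, 1:]\<close> commutes with \<open>cm Q\<close>.\<close>

lemma charpoly_diagonalization:
  fixes Q :: "real^'n^'n"
  assumes "orthogonal_matrix Q"
  shows "charpoly (Q ** diag_mat l ** transpose Q) = (\<Prod>i\<in>UNIV. [:- l i, 1:])"
proof -
  define cm :: "real^'n^'n \<Rightarrow> real poly^'n^'n" where "cm A = (\<chi> i j. [:A $ i $ j:])" for A
  have cm_mult: "cm (A ** B) = cm A ** cm B" for A B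
  proof -
    have "[:sum f F:] = (\<Sum>k\<in>F. [:f k:])" for f :: "'n \<Rightarrow> real" and F
      by (rule poly_eqI) (simp add: coeff_sum coeff_pCons split: nat.split)
    then show ?thesis by (simp add: cm_def matrix_matrix_mult_def vec_eq_iff mult_pCons_left mult.commute)
  qed
  have cm1: "cm (mat 1) = mat 1" by (simp add: cm_def mat_def vec_eq_iff)
  have QQ: "cm Q ** cm (transpose Q) = mat 1"
    using assms cm1 by (simp add: orthogonal_matrix_def flip: cm_mult)
  have matX: "mat [:0, 1:] = cm Q ** mat [:0, 1:] ** cm (transpose Q)"
  proof -
    have "cm Q ** mat [:0, 1:] = mat [:0, 1:] ** cm Q"
      by (simp add: vec_eq_iff matrix_matrix_mult_def mat_def if_zero_mult if_distrib[of "smult _"]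
          cm_def cong: if_cong)
    then have "cm Q ** mat [:0, 1:] ** cm (transpose Q) = mat [:0, 1:] ** (cm Q ** cm (transpose Q))"
      by (simp add: matrix_mul_assoc)
    then show ?thesis by (simp add: QQ)
  qed
  have "charpoly (Q ** diag_mat l ** transpose Q)
      = det (mat [:0, 1:] - cm (Q ** diag_mat l ** transpose Q))"
    by (simp add: charpoly_def cm_def)
  also have "mat [:0, 1:] - cm (Q ** diag_mat l ** transpose Q)
      = cm Q ** (mat [:0, 1:] - cm (diag_mat l)) ** cm (transpose Q)"
    by (subst matX) (simp add: cm_mult matrix_diff_distrib)
  also have "det \<dots> = det (cm Q ** cm (transpose Q)) * det (mat [:0, 1:] - cm (diag_mat l))"
    by (simp add: det_mul mult_ac)
  also have "\<dots> = (\<Prod>i\<in>UNIV. [:- l i, 1:])"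
    unfolding QQ det_I mult_1_left by (subst det_diagonal[of "_ - _"]) (auto simp: cm_def mat_def)
  finally show ?thesis .
qed

text \<open>The sorted list and the values \<open>l\<close> are listings of the same multiset of
  roots, so they differ by a permutation. \<open>s\<close> composes the shift from 1-based
  positions, this permutation and an enumeration of \<open>'n\<close>. In symmetric expressions
  \<open>s\<close> then drops out.\<close>

lemma eigval_diagonalization:
  fixes Q :: "real^'n^'n"
  assumes "orthogonal_matrix Q"
  obtains s where "bij_betw s {1..CARD('n)} (UNIV :: 'n set)"
    "\<And>i. i \<in> {1..CARD('n)} \<Longrightarrow> eigval (Q ** diag_mat l ** transpose Q) i = l (s i)"
proof -
  let ?X = "Q ** diag_mat l ** transpose Q"
  have "proots (charpoly ?X) = (\<Sum>i\<in>UNIV. {#l i#})"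
    unfolding charpoly_diagonalization[OF assms] by (subst proots_prod) auto
  also have "\<dots> = image_mset l (mset_set UNIV)"
    by (simp add: sum_unfold_sum_mset flip: image_mset.comp)
  finally have pr: "proots (charpoly ?X) = image_mset l (mset_set UNIV)" .
  obtain xs where xs: "set xs = (UNIV :: 'n set)" "distinct xs"
    using finite_distinct_list[of "UNIV :: 'n set"] by auto
  have len: "length xs = CARD('n)" using xs distinct_card by metis
  have "mset (eigenvalue_list ?X) = mset (map l xs)"
    using xs by (simp add: eigenvalue_list_def pr mset_set_set[symmetric] flip: mset_set_set)
  then obtain p where p: "p permutes {..<length (map l xs)}"
    "permute_list p (map l xs) = eigenvalue_list ?X"
    by (rule mset_eq_permutation)
  have p': "bij_betw p {..<CARD('n)} {..<CARD('n)}"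
    using p(1) len by (simp add: permutes_imp_bij)
  have "bij_betw (\<lambda>i. i - 1) {1..CARD('n)} {..<CARD('n)}"
    by (rule bij_betw_byWitness[where f' = Suc]) auto
  moreover have "bij_betw ((!) xs) {..<CARD('n)} UNIV"
    using bij_betw_nth[OF xs(2)] xs(1) len by simp
  ultimately have "bij_betw ((!) xs \<circ> (p \<circ> (\<lambda>i. i - 1))) {1..CARD('n)} UNIV"
    using p' by (blast intro: bij_betw_trans)
  moreover have "eigval ?X i = l (((!) xs \<circ> (p \<circ> (\<lambda>i. i - 1))) i)" if "i \<in> {1..CARD('n)}" for i
  proof -
    have i: "i - 1 < CARD('n)" using that by auto
    then have "p (i - 1) < CARD('n)" using p' by (auto simp: bij_betw_def)
    then show ?thesis
      unfolding eigval_def p(2)[symmetric] using i len p(1) by (simp add: permute_list_nth)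
  qed
  ultimately show ?thesis using that by blast
qed

section \<open>Eigenvalues, roots and cones\<close>

text \<open>\<open>R\<close> orients each pair in exactly one way. It is instantiated with the order
  of list positions, and with an order pulled back along an injection into the naturals, since
  \<open>'n\<close> itself is unordered.\<close>

lemma bij_betw_doubletons:
  fixes s :: "'b \<Rightarrow> 'a"
  assumes s: "bij_betw s I UNIV"
    and R: "\<And>i j. i \<in> I \<Longrightarrow> j \<in> I \<Longrightarrow> i \<noteq> j \<Longrightarrow> R i j \<noteq> R j i" "\<And>i. \<not> R i i"
  shows "bij_betw (\<lambda>(i, j). {s i, s j}) {(i, j). i \<in> I \<and> j \<in> I \<and> R i j} {A. card A = 2}"
  unfolding bij_betw_def
proof (intro conjI set_eqI iffI)
  have inj: "inj_on s I" using s by (simp add: bij_betw_def)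
  then have eq: "s i = s j \<longleftrightarrow> i = j" if "i \<in> I" "j \<in> I" for i j
    using that by (auto simp: inj_on_def)
  show "inj_on (\<lambda>(i, j). {s i, s j}) {(i, j). i \<in> I \<and> j \<in> I \<and> R i j}"
    using R by (auto simp: inj_on_def doubleton_eq_iff eq)
  {
    fix A assume "A \<in> (\<lambda>(i, j). {s i, s j}) ` {(i, j). i \<in> I \<and> j \<in> I \<and> R i j}"
    then obtain i j where ij: "i \<in> I" "j \<in> I" "R i j" "A = {s i, s j}" by auto
    then have "s i \<noteq> s j" using R(2) eq by metis
    then show "A \<in> {A. card A = 2}" using ij by simp
  next
    fix A :: "'a set" assume "A \<in> {A. card A = 2}"
    then obtain x y where A: "A = {x, y}" "x \<noteq> y" by (auto simp: card_2_iff)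
    obtain i j where ij: "i \<in> I" "j \<in> I" "s i = x" "s j = y"
      using s by (metis UNIV_I bij_betw_imp_surj_on imageE)
    then have "i \<noteq> j" using A by auto
    then have "R i j \<or> R j i" using R(1) ij by blast
    then show "A \<in> (\<lambda>(i, j). {s i, s j}) ` {(i, j). i \<in> I \<and> j \<in> I \<and> R i j}"
    proof
      assume "R i j"
      then show ?thesis using ij A by (intro image_eqI[of _ _ "(i, j)"]) auto
    next
      assume "R j i"
      then show ?thesis using ij A by (intro image_eqI[of _ _ "(j, i)"]) auto
    qed
  }
qed

lemma prod_ordered_pairs:
  fixes s :: "'b \<Rightarrow> 'a" and l :: "'a \<Rightarrow> 'c::comm_semiring_1"
  assumes s: "bij_betw s I UNIV"
    and R: "\<And>i j. i \<in> I \<Longrightarrow> j \<in> I \<Longrightarrow> i \<noteq> j \<Longrightarrow> R i j \<noteq> R j i" "\<And>i. \<not> R i i"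
  shows "(\<Prod>(i, j) | i \<in> I \<and> j \<in> I \<and> R i j. l (s i) + l (s j)) = (\<Prod>A | card A = 2. sum l A)"
proof -
  have "(\<Prod>(i, j) | i \<in> I \<and> j \<in> I \<and> R i j. l (s i) + l (s j))
      = (\<Prod>p\<in>{(i, j). i \<in> I \<and> j \<in> I \<and> R i j}. sum l ((\<lambda>(i, j). {s i, s j}) p))"
  proof (rule prod.cong, rule refl, clarify)
    fix i j assume "i \<in> I" "j \<in> I" "R i j"
    then have "s i \<noteq> s j" using R(2) s by (metis bij_betw_imp_inj_on inj_on_eq_iff)
    then show "l (s i) + l (s j) = sum l {s i, s j}" by simp
  qed
  also have "\<dots> = (\<Prod>A | card A = 2. sum l A)"
    by (rule prod.reindex_bij_betw[OF bij_betw_doubletons[OF s R]])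
  finally show ?thesis .
qed

lemma sum_card_pred:
  fixes g :: "'n::finite set \<Rightarrow> 'a::comm_monoid_add"
  shows "(\<Sum>A | card A = CARD('n) - 1. g A) = (\<Sum>k\<in>UNIV. g (- {k}))"
proof -
  have "{A :: 'n set. card A = CARD('n) - 1} = (\<lambda>k. - {k}) ` UNIV"
  proof (intro set_eqI iffI)
    fix A :: "'n set" assume "A \<in> {A. card A = CARD('n) - 1}"
    then have "card (- A) = 1" by (simp add: Compl_eq_Diff_UNIV card_Diff_subset Suc_leI)
    then obtain k where "- A = {k}" by (auto simp: card_1_singleton_iff)
    then show "A \<in> (\<lambda>k. - {k}) ` UNIV" by (metis double_complement rangeI)
  qed (auto simp: Compl_eq_Diff_UNIV card_Diff_subset)
  moreover have "inj (\<lambda>k :: 'n. - {k})" by (auto simp: inj_on_def)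
  ultimately show ?thesis by (simp add: sum.reindex)
qed

section \<open>Symmetric functions of the eigenvalues\<close>

lemma q_poly_diagonalization:
  fixes Q :: "real^'n^'n"
  assumes "orthogonal_matrix Q"
  shows "q_poly (Q ** diag_mat l ** transpose Q) = (\<Prod>A | card A = 2. sum l A)"
proof -
  obtain s where s: "bij_betw s {1..CARD('n)} (UNIV :: 'n set)"
    "\<And>i. i \<in> {1..CARD('n)} \<Longrightarrow> eigval (Q ** diag_mat l ** transpose Q) i = l (s i)"
    using eigval_diagonalization[OF assms] by blast
  have "q_poly (Q ** diag_mat l ** transpose Q)
     = (\<Prod>(i, j) | i \<in> {1..CARD('n)} \<and> j \<in> {1..CARD('n)} \<and> i < j. l (s i) + l (s j))"
    unfolding q_poly_def by (rule prod.cong) (auto simp: s(2))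
  also have "\<dots> = (\<Prod>A | card A = 2. sum l A)"
    by (rule prod_ordered_pairs[OF s(1)]) auto
  finally show ?thesis .
qed

lemma elem_sym_diagonalization:
  fixes Q :: "real^'n^'n"
  assumes "orthogonal_matrix Q"
  shows "elem_sym k (Q ** diag_mat l ** transpose Q) = (\<Sum>A | card A = k. prod l A)"
proof -
  obtain s where s: "bij_betw s {1..CARD('n)} (UNIV :: 'n set)"
    "\<And>i. i \<in> {1..CARD('n)} \<Longrightarrow> eigval (Q ** diag_mat l ** transpose Q) i = l (s i)"
    using eigval_diagonalization[OF assms] by blast
  have inj: "inj_on s A" if "A \<subseteq> {1..CARD('n)}" for A
    using s(1) that by (metis bij_betw_imp_inj_on inj_on_subset)
  have "bij_betw ((`) s) {A \<in> Pow {1..CARD('n)}. card A = k} {A \<in> Pow UNIV. card A = k}"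
  proof (rule bij_betw_subset[OF bij_betw_Pow[OF s(1)]])
    show "(`) s ` {A \<in> Pow {1..CARD('n)}. card A = k} = {A \<in> Pow UNIV. card A = k}"
    proof (intro set_eqI iffI)
      fix A :: "'n set" assume A: "A \<in> {A \<in> Pow UNIV. card A = k}"
      obtain A' where A': "A' \<subseteq> {1..CARD('n)}" "A = s ` A'"
        using s(1) by (metis bij_betw_def subset_UNIV subset_imageE)
      then have "card A' = k" using A inj by (simp add: card_image)
      then show "A \<in> (`) s ` {A \<in> Pow {1..CARD('n)}. card A = k}" using A' by auto
    qed (use inj in \<open>auto simp: card_image\<close>)
  qed auto
  then have "bij_betw ((`) s) {A. A \<subseteq> {1..CARD('n)} \<and> card A = k} {A. card A = k}"
    by simp
  note b = sum.reindex_bij_betw[OF this, of "prod l", symmetric]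
  show ?thesis unfolding b elem_sym_def
  proof (intro sum.cong refl)
    fix A assume A: "A \<in> {A. A \<subseteq> {1..CARD('n)} \<and> card A = k}"
    have "(\<Prod>i\<in>A. eigval (Q ** diag_mat l ** transpose Q) i) = (\<Prod>i\<in>A. l (s i))"
      using A by (intro prod.cong s(2)) auto
    then show "(\<Prod>i\<in>A. eigval (Q ** diag_mat l ** transpose Q) i) = prod l (s ` A)"
      using A inj by (simp add: prod.reindex)
  qed
qed

lemma elem_sym_pred_diagonalization:
  fixes Q :: "real^'n^'n"
  assumes "orthogonal_matrix Q"
  shows "elem_sym (CARD('n) - 1) (Q ** diag_mat l ** transpose Q) = (\<Sum>k\<in>UNIV. \<Prod>i\<in>-{k}. l i)"
  by (simp only: elem_sym_diagonalization[OF assms] sum_card_pred)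

text \<open>Moves the condition from the sorted list to the diagonal of any chosen diagonalization,
  where the roots along the identity direction can be read off.\<close>

lemma eigval_pair_sums_nonneg_iff:
  fixes Q :: "real^'n^'n"
  assumes "orthogonal_matrix Q" and X: "X = Q ** diag_mat l ** transpose Q"
  shows "(\<forall>i j. 1 \<le> i \<and> i < j \<and> j \<le> CARD('n) \<longrightarrow> eigval X i + eigval X j \<ge> 0) \<longleftrightarrow>
    (\<forall>A. card A = 2 \<longrightarrow> 0 \<le> sum l A)"
proof -
  obtain s where s: "bij_betw s {1..CARD('n)} (UNIV :: 'n set)"
    "\<And>i. i \<in> {1..CARD('n)} \<Longrightarrow> eigval X i = l (s i)"
    using eigval_diagonalization[OF assms(1)] X by blast
  have "bij_betw (\<lambda>(i, j). {s i, s j})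
      {(i, j). i \<in> {1..CARD('n)} \<and> j \<in> {1..CARD('n)} \<and> i < j} {A. card A = 2}"
    by (rule bij_betw_doubletons[OF s(1)]) auto
  then have "(\<forall>A\<in>{A. card A = 2}. 0 \<le> sum l A) \<longleftrightarrow>
      (\<forall>(i, j)\<in>{(i, j). i \<in> {1..CARD('n)} \<and> j \<in> {1..CARD('n)} \<and> i < j}. 0 \<le> sum l {s i, s j})"
    by (subst bij_betw_imp_surj_on[symmetric]) auto
  also have "\<dots> \<longleftrightarrow> (\<forall>i j. 1 \<le> i \<and> i < j \<and> j \<le> CARD('n) \<longrightarrow> eigval X i + eigval X j \<ge> 0)"
  proof -
    have "sum l {s i, s j} = eigval X i + eigval X j"
      if "1 \<le> i" "i < j" "j \<le> CARD('n)" for i j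
    proof -
      have "s i \<noteq> s j" using that bij_betw_imp_inj_on[OF s(1)] by (auto dest: inj_onD)
      then show ?thesis using that s(2) by simp
    qed
    then show ?thesis by auto
  qed
  finally show ?thesis by auto
qed

section \<open>Restriction to lines in the direction of the identity\<close>

lemma diagonalization_scaleR:
  fixes Q :: "real^'n^'n"
  shows "c *\<^sub>R (Q ** diag_mat l ** transpose Q) = Q ** diag_mat (\<lambda>i. c * l i) ** transpose Q"
proof -
  have "diag_mat (\<lambda>i. c * l i) = c *\<^sub>R diag_mat l" by (simp add: vec_eq_iff)
  then show ?thesis by (simp only: matrix_scalar_ac scalar_matrix_assoc)
qed

lemma mat1_diagonalization:
  fixes Q :: "real^'n^'n"
  assumes "orthogonal_matrix Q"
  shows "mat 1 = Q ** diag_mat (\<lambda>_. 1) ** transpose Q"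
proof -
  have "diag_mat (\<lambda>_. 1) = (mat 1 :: real^'n^'n)" by (simp add: diag_mat_def mat_def)
  then show ?thesis using assms by (simp add: orthogonal_matrix_def)
qed

text \<open>One \<open>Q\<close> diagonalizes the whole line, so the restricted polynomials become
  explicit in \<open>t\<close>.\<close>

lemma diagonalization_diff_mat1:
  fixes Q :: "real^'n^'n"
  assumes "orthogonal_matrix Q"
  shows "Q ** diag_mat l ** transpose Q - t *\<^sub>R mat 1
    = Q ** diag_mat (\<lambda>i. l i - t) ** transpose Q"
proof -
  note mat1_diagonalization[OF assms]
  moreover have "diag_mat (\<lambda>i. l i - t) = diag_mat l - diag_mat (\<lambda>i. t * 1)"
    by (simp add: vec_eq_iff)
  ultimately show ?thesis
    by (simp only: diagonalization_scaleR matrix_diff_distrib)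
qed

text \<open>Each two-element sum loses \<open>t\<close> twice, hence the coefficient
  \<open>-2\<close> and roots at half the pair sums.\<close>

lemma line_poly_q:
  fixes Q :: "real^'n^'n"
  assumes "orthogonal_matrix Q"
  shows "line_poly q_poly (mat 1) (Q ** diag_mat l ** transpose Q)
    = (\<Prod>A | card A = 2. [:sum l A, -2:])"
proof (rule line_poly_eqI)
  fix t
  have "(\<Sum>i\<in>A. l i - t) = sum l A - 2 * t" if "card A = 2" for A
    using that by (simp add: sum_subtractf)
  then show "poly (\<Prod>A | card A = 2. [:sum l A, -2:]) t
      = q_poly (Q ** diag_mat l ** transpose Q - t *\<^sub>R mat 1)"
    unfolding diagonalization_diff_mat1[OF assms] q_poly_diagonalization[OF assms] poly_prod
    by (intro prod.cong) auto
qed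

lemma line_poly_elem_sym_pred:
  fixes Q :: "real^'n^'n"
  assumes "orthogonal_matrix Q"
  shows "line_poly (elem_sym (CARD('n) - 1)) (mat 1) (Q ** diag_mat l ** transpose Q)
    = (\<Sum>k\<in>UNIV. \<Prod>i\<in>-{k}. [:l i, -1:])"
  by (rule line_poly_eqI)
    (simp add: diagonalization_diff_mat1[OF assms] elem_sym_pred_diagonalization[OF assms]
      poly_sum poly_prod del: One_nat_def)

lemma map_poly_of_real_prod:
  "map_poly of_real (prod f A) = (\<Prod>a\<in>A. map_poly of_real (f a) :: complex poly)"
proof -
  have "map_poly of_real (p * q) = (map_poly of_real p * map_poly of_real q :: complex poly)" for p q
    by (rule poly_eqI) (simp add: coeff_map_poly coeff_mult)
  then show ?thesis by (induction A rule: infinite_finite_induct) simp_all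
qed

lemma poly_map_poly_of_real:
  "poly (map_poly of_real p) (of_real x) = (of_real (poly p x) :: complex)"
  by (induction p) (simp_all add: map_poly_pCons)

text \<open>The polynomial splits into real linear factors, so even its complex roots are these real
  numbers; hyperbolicity and the cone both follow from this.\<close>

lemma line_poly_q_root_iff:
  fixes Q :: "real^'n^'n"
  assumes "orthogonal_matrix Q"
  shows "poly (map_poly complex_of_real (line_poly q_poly (mat 1) (Q ** diag_mat l ** transpose Q))) z = 0
    \<longleftrightarrow> (\<exists>A. card A = 2 \<and> z = of_real (sum l A / 2))"
proof -
  have "poly (map_poly complex_of_real [:a, -2:]) z = 0 \<longleftrightarrow> z = of_real (a / 2)" for a
    by (auto simp: map_poly_pCons field_simps)
  then show ?thesis
    by (simp add: line_poly_q[OF assms] map_poly_of_real_prod poly_prod)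
qed

section \<open>The cone of \<open>q\<close> and its inclusion of the derivative cone\<close>

lemma hyperbolicity_cone_q_iff:
  fixes Q :: "real^'n^'n"
  assumes "orthogonal_matrix Q" and X: "X = Q ** diag_mat l ** transpose Q"
  shows "X \<in> hyperbolicity_cone sym_matrices q_poly (mat 1) \<longleftrightarrow>
    (\<forall>A. card A = 2 \<longrightarrow> 0 \<le> sum l A)"
proof -
  have "complex_of_real (a / 2) \<in> \<real>\<^sub>\<ge>\<^sub>0 \<longleftrightarrow> 0 \<le> a" for a
    by (simp only: nonneg_Reals_of_real_iff) simp
  note nonneg = this
  have "X \<in> hyperbolicity_cone sym_matrices q_poly (mat 1) \<longleftrightarrow>
      (\<forall>z. (\<exists>A. card A = 2 \<and> z = complex_of_real (sum l A / 2)) \<longrightarrow> z \<in> \<real>\<^sub>\<ge>\<^sub>0)"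
    unfolding hyperbolicity_cone_def X
    by (simp only: mem_Collect_eq diagonalization_sym line_poly_q_root_iff[OF assms(1)] simp_thms)
  also have "\<dots> \<longleftrightarrow> (\<forall>A. card A = 2 \<longrightarrow> complex_of_real (sum l A / 2) \<in> \<real>\<^sub>\<ge>\<^sub>0)"
    by fast
  finally show ?thesis by (simp only: nonneg)
qed

lemma hyperbolicity_cone_q:
  "hyperbolicity_cone sym_matrices (q_poly :: real^'n^'n \<Rightarrow> real) (mat 1) =
     {X \<in> sym_matrices. \<forall>i j. 1 \<le> i \<and> i < j \<and> j \<le> CARD('n) \<longrightarrow> eigval X i + eigval X j \<ge> 0}"
  (is "?C = ?D")
proof (intro set_eqI)
  fix X :: "real^'n^'n"
  show "X \<in> ?C \<longleftrightarrow> X \<in> ?D"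
  proof (cases "X \<in> sym_matrices")
    case True
    then obtain Q l where "orthogonal_matrix Q" "X = Q ** diag_mat l ** transpose Q"
      by (rule sym_matrix_diagonalization)
    then show ?thesis
      using True hyperbolicity_cone_q_iff[of Q X l] eigval_pair_sums_nonneg_iff[of Q X l] by simp
  qed (simp add: hyperbolicity_cone_def)
qed

text \<open>The witness interval is \<open>[l i, (l i + l j) / 2]\<close> for the two smallest values \<open>l i \<le> l j\<close>:
  the polynomial is nonnegative at the left end, and at the midpoint the terms for \<open>i\<close> and \<open>j\<close>
  cancel while all others are nonpositive.\<close>

lemma derivative_negative_root:
  fixes l :: "'n::finite \<Rightarrow> real"
  assumes neg: "card A0 = 2" "sum l A0 < 0"
  obtains t where "t < 0" "(\<Sum>k\<in>UNIV. \<Prod>i\<in>-{k}. l i - t) = 0"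
proof -
  define P where "P t = (\<Sum>k\<in>UNIV. \<Prod>i\<in>-{k}. l i - t)" for t
  obtain x y where xy: "A0 = {x, y}" "x \<noteq> y" using neg(1) by (auto simp: card_2_iff)
  define i where "i = arg_min_on l UNIV"
  have i: "l i \<le> l k" for k unfolding i_def by (rule arg_min_least) auto
  have ne: "- {i} \<noteq> {}" using xy by auto
  define j where "j = arg_min_on l (- {i})"
  have j: "j \<noteq> i" "\<And>k. k \<noteq> i \<Longrightarrow> l j \<le> l k"
    unfolding j_def using ne arg_min_if_finite(1)[of "- {i}" l]
    by (auto intro: arg_min_least)
  have ij: "l i + l j < 0"
  proof -
    have "l i + l j \<le> l x + l y" using i[of x] i[of y] j(2)[of x] j(2)[of y] xy by (cases "x = i") auto
    then show ?thesis using neg xy by simp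
  qed
  define t0 where "t0 = (l i + l j) / 2"
  have le: "l i \<le> t0" "t0 \<le> l j" using i[of j] by (auto simp: t0_def)
  have "P (l i) \<ge> 0" unfolding P_def using i by (intro sum_nonneg prod_nonneg) auto
  moreover have "P t0 \<le> 0"
  proof -
    define W where "W = (\<Prod>k\<in>-{i, j}. l k - t0)"
    have fac: "(\<Prod>m\<in>-{k}. l m - t0) = (l a - t0) * (\<Prod>m\<in>-{a, k}. l m - t0)" if "a \<noteq> k" for a k
    proof -
      have "- {k} = insert a (- {a, k})" using that by auto
      then have "(\<Prod>m\<in>-{k}. l m - t0) = (\<Prod>m\<in>insert a (- {a, k}). l m - t0)" by (rule arg_cong)
      also have "\<dots> = (l a - t0) * (\<Prod>m\<in>-{a, k}. l m - t0)" by (rule prod.insert) auto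
      finally show ?thesis .
    qed
    have "P t0 = (\<Sum>k\<in>-{i, j}. \<Prod>m\<in>-{k}. l m - t0) + (\<Sum>k\<in>{i, j}. \<Prod>m\<in>-{k}. l m - t0)"
      unfolding P_def Compl_eq_Diff_UNIV by (rule sum.subset_diff) auto
    also have "(\<Sum>k\<in>{i, j}. \<Prod>m\<in>-{k}. l m - t0) = (l j - t0) * W + (l i - t0) * W"
    proof -
      have "(\<Prod>m\<in>-{i}. l m - t0) = (l j - t0) * W" "(\<Prod>m\<in>-{j}. l m - t0) = (l i - t0) * W"
        unfolding W_def using fac[OF j(1)] fac[OF j(1)[symmetric]] by (simp_all only: insert_commute)
      then show ?thesis using j(1) by simp
    qed
    also have "\<dots> = 0" by (simp add: t0_def flip: distrib_right)
    \<comment> \<open>These terms retain the factor \<open>l i - t0\<close>, which is nonpositive,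
      while every other factor is at least \<open>l j - t0\<close>, which is nonnegative.\<close>
    also have "(\<Sum>k\<in>-{i, j}. \<Prod>m\<in>-{k}. l m - t0) \<le> 0"
    proof (rule sum_nonpos)
      fix k assume k: "k \<in> - {i, j}"
      have "(\<Prod>m\<in>-{i, k}. l m - t0) \<ge> 0"
      proof (rule prod_nonneg)
        fix m assume "m \<in> - {i, k}"
        then have "l j \<le> l m" using j by auto
        then show "0 \<le> l m - t0" using le by simp
      qed
      then show "(\<Prod>m\<in>-{k}. l m - t0) \<le> 0"
        using k le fac[of i k] by (auto simp: mult_nonpos_nonneg)
    qed
    finally show ?thesis by simp
  qed
  moreover have "continuous_on {l i..t0} P"
    unfolding P_def by (intro continuous_intros)
  ultimately obtain t where "l i \<le> t" "t \<le> t0" "P t = 0"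
    using IVT2'[of P t0 0 "l i"] le(1) by blast
  moreover have "t0 < 0" using ij by (simp add: t0_def)
  ultimately show ?thesis using that[of t] by (simp add: P_def)
qed

lemma psd_derivative_cone_subset:
  "(psd_derivative_cone :: (real^'n^'n) set) \<subseteq> hyperbolicity_cone sym_matrices q_poly (mat 1)"
proof
  fix X :: "real^'n^'n" assume X: "X \<in> psd_derivative_cone"
  then have "X \<in> sym_matrices" by (simp add: psd_derivative_cone_def hyperbolicity_cone_def)
  then obtain Q l where Q: "orthogonal_matrix Q" "X = Q ** diag_mat l ** transpose Q"
    by (rule sym_matrix_diagonalization)
  show "X \<in> hyperbolicity_cone sym_matrices q_poly (mat 1)"
    unfolding hyperbolicity_cone_q_iff[OF Q]
  proof (intro allI impI, rule ccontr)
    fix A :: "'n set" assume "card A = 2" "\<not> 0 \<le> sum l A"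
    then obtain t where t: "t < 0" "(\<Sum>k\<in>UNIV. \<Prod>i\<in>-{k}. l i - t) = 0"
      using derivative_negative_root[of A l] by auto
    let ?P = "line_poly (elem_sym (CARD('n) - 1)) (mat 1) X"
    have "poly ?P t = 0"
      using t(2) by (simp add: Q(2) line_poly_elem_sym_pred[OF Q(1)] poly_sum poly_prod
          del: One_nat_def)
    then have "poly (map_poly complex_of_real ?P) (of_real t) = 0"
      by (simp add: poly_map_poly_of_real)
    then have "complex_of_real t \<in> \<real>\<^sub>\<ge>\<^sub>0"
      using X by (auto simp: psd_derivative_cone_def hyperbolicity_cone_def)
    then show False using t(1) by simp
  qed
qed

section \<open>\<open>q\<close> is a polynomial\<close>

text \<open>Triangularity is measured by a rank function because \<open>'n\<close> has no order. If
  a permutation other than the identity contributed, each moved index would go to a strictly larger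
  rank, although a permutation preserves the sum of all ranks.\<close>

lemma det_triangular_rank:
  fixes A :: "'a::comm_ring_1^'n^'n" and r :: "'n \<Rightarrow> nat"
  assumes tri: "\<And>i j. i \<noteq> j \<Longrightarrow> \<not> r i < r j \<Longrightarrow> A $ i $ j = 0"
  shows "det A = (\<Prod>i\<in>UNIV. A $ i $ i)"
proof -
  have zero: "of_int (sign p) * (\<Prod>i\<in>UNIV. A $ i $ p i) = 0"
    if p: "p permutes UNIV" "p \<noteq> id" for p
  proof -
    have "\<exists>i. A $ i $ p i = 0"
    proof (rule ccontr)
      assume "\<nexists>i. A $ i $ p i = 0"
      then have le: "p i = i \<or> r i < r (p i)" for i using tri by metis
      obtain i0 where "p i0 \<noteq> i0" using p(2) by (auto simp: fun_eq_iff)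
      then have "r i0 < r (p i0)" using le by blast
      moreover have "r i \<le> r (p i)" for i using le[of i] by auto
      ultimately have "(\<Sum>i\<in>UNIV. r i) < (\<Sum>i\<in>UNIV. r (p i))"
        by (intro sum_strict_mono_ex1) auto
      then show False using sum.permute[OF p(1), of r] by (simp add: o_def)
    qed
    then have "(\<Prod>i\<in>UNIV. A $ i $ p i) = 0" by (metis UNIV_I finite prod_zero)
    then show ?thesis by simp
  qed
  have "det A = (\<Sum>p\<in>{id}. of_int (sign p) * (\<Prod>i\<in>UNIV. A $ i $ p i))"
    unfolding det_def
    by (rule sum.mono_neutral_right) (use zero in \<open>auto simp: finite_permutations permutes_id\<close>)
  then show ?thesis by simp
qed

lemma sum_UNIV_prod:
  "(\<Sum>p\<in>UNIV. f p) = (\<Sum>k\<in>UNIV. \<Sum>l\<in>UNIV. f (k, l))"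
  by (simp add: sum.cartesian_product flip: UNIV_Times_UNIV)

section \<open>Operators on the space of matrices\<close>

text \<open>In the basis of matrix units this is the conjugation sending \<open>A\<close> to
  \<open>Q ** A ** transpose Q\<close>, for orthogonal \<open>Q\<close>.\<close>

definition kron_square :: "real^'n^'n \<Rightarrow> real^('n \<times> 'n)^('n \<times> 'n)" where
  "kron_square Q = (\<chi> p q. Q $ fst p $ fst q * Q $ snd p $ snd q)"

lemma kron_square_orthogonal:
  assumes "orthogonal_matrix Q"
  shows "kron_square Q ** kron_square (transpose Q) = mat 1"
proof -
  have "(kron_square Q ** kron_square (transpose Q)) $ p $ q = mat 1 $ p $ q" for p q
  proof -
    have "(kron_square Q ** kron_square (transpose Q)) $ p $ q
      = (\<Sum>k\<in>UNIV. \<Sum>l\<in>UNIV. (Q $ fst p $ k * Q $ fst q $ k) * (Q $ snd p $ l * Q $ snd q $ l))"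
      by (simp add: matrix_matrix_mult_def sum_UNIV_prod kron_square_def transpose_def mult_ac)
    also have "\<dots> = mat 1 $ p $ q"
      by (simp add: orthogonal_matrix_entries[OF assms] prod_eq_iff mat_def
          flip: sum_distrib_left sum_distrib_right)
    finally show ?thesis .
  qed
  then show ?thesis by (simp add: vec_eq_iff)
qed

text \<open>The matrix of the operator on all \<open>n \<times> n\<close> matrices that sends a skew-symmetric \<open>A\<close> to
  \<open>X A + A X\<close> and fixes symmetric matrices, in the basis of matrix units. On skew-symmetric
  matrices its eigenvalues are the sums \<open>\<lambda>\<^sub>i + \<lambda>\<^sub>j\<close>, so its determinant is \<open>q\<close>.\<close>

definition skew_sylvester :: "real^'n^'n \<Rightarrow> real^('n \<times> 'n)^('n \<times> 'n)" where
  "skew_sylvester X = (\<chi> p q. let (i, j) = p; (k, l) = q in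
     ((if l = j then X $ i $ k else 0) - (if j = k then X $ i $ l else 0)
      + (if i = k then X $ l $ j else 0) - (if i = l then X $ k $ j else 0)
      + (if i = k \<and> j = l then 1 else 0) + (if i = l \<and> j = k then 1 else 0)) / 2)"

text \<open>An operator preserving the span of each pair of matrix units E_ab and E_ba:
  \<open>u\<close> is the coefficient kept, \<open>v\<close> the one passed to the transposed unit.
  For a = b both land in the same entry.\<close>

definition swap_mat :: "('n::finite \<times> 'n \<Rightarrow> real) \<Rightarrow> ('n \<times> 'n \<Rightarrow> real) \<Rightarrow> real^('n \<times> 'n)^('n \<times> 'n)" where
  "swap_mat u v = (\<chi> p q. (if p = q then u q else 0) + (if p = prod.swap q then v q else 0))"

lemma swap_mat_nth:
  "swap_mat u v $ p $ q = (if p = q then u q else 0) + (if p = prod.swap q then v q else 0)"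
  by (simp add: swap_mat_def)

lemma mult_swap_mat_nth:
  "(A ** swap_mat u v) $ p $ q = A $ p $ q * u q + A $ p $ prod.swap q * v q"
  by (simp add: matrix_matrix_mult_def swap_mat_nth distrib_left sum.distrib if_zero_mult
      cong: if_cong)

lemma skew_sylvester_diag:
  "skew_sylvester (diag_mat l) =
    swap_mat (\<lambda>(a, b). (l a + l b + 1) / 2) (\<lambda>(a, b). (1 - l a - l b) / 2)"
proof -
  have "skew_sylvester (diag_mat l) $ (i, j) $ (a, b) =
    swap_mat (\<lambda>(a, b). (l a + l b + 1) / 2) (\<lambda>(a, b). (1 - l a - l b) / 2) $ (i, j) $ (a, b)"
    for i j a b
    by (cases "i = a"; cases "j = b"; cases "i = b"; cases "j = a")
      (simp_all add: skew_sylvester_def swap_mat_nth field_simps)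
  then show ?thesis by (simp add: vec_eq_iff split_paired_all)
qed

text \<open>Conjugation by \<open>Q\<close> respects the splitting into skew-symmetric and symmetric
  matrices and turns the operator for the diagonal matrix into the one for \<open>X\<close>.\<close>

lemma skew_sylvester_conj:
  fixes Q :: "real^'n^'n"
  assumes Q: "orthogonal_matrix Q" and X: "X = Q ** diag_mat l ** transpose Q"
  shows "skew_sylvester X ** kron_square Q = kron_square Q ** skew_sylvester (diag_mat l)"
proof -
  have "X ** Q = Q ** diag_mat l ** (transpose Q ** Q)"
    by (simp add: X matrix_mul_assoc)
  then have "X ** Q = Q ** diag_mat l" using Q by (simp add: orthogonal_matrix_def)
  then have "(X ** Q) $ i $ a = l a * Q $ i $ a" for i a
    by (simp add: matrix_mult_diag_mat_nth)
  then have XQ: "(\<Sum>k\<in>UNIV. X $ i $ k * Q $ k $ a) = l a * Q $ i $ a" for i a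
    by (simp add: matrix_matrix_mult_def)
  have sym: "X $ i $ j = X $ j $ i" for i j
    using diagonalization_sym[of Q l]
    by (simp add: X sym_matrices_def vec_eq_iff transpose_def)
  have "(skew_sylvester X ** kron_square Q) $ (i, j) $ (a, b)
      = (kron_square Q ** skew_sylvester (diag_mat l)) $ (i, j) $ (a, b)" for i j a b
  proof -
    have XQ': "(\<Sum>k\<in>UNIV. X $ k $ i * Q $ k $ a) = l a * Q $ i $ a" for i a
    proof -
      have "(\<Sum>k\<in>UNIV. X $ k $ i * Q $ k $ a) = (\<Sum>k\<in>UNIV. X $ i $ k * Q $ k $ a)"
        by (intro sum.cong refl arg_cong2[of _ _ _ _ "(*)"] sym)
      then show ?thesis by (simp only: XQ)
    qed
    \<comment> \<open>Facts 1 to 6 evaluate the six summands in the definition of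
      \<open>skew_sylvester\<close>, in that order.\<close>
    have 1: "(\<Sum>k\<in>UNIV. \<Sum>m\<in>UNIV. (if m = j then X $ i $ k else 0) * (Q $ k $ a * Q $ m $ b))
        = l a * Q $ i $ a * Q $ j $ b"
      by (simp add: if_zero_mult mult.assoc[symmetric] XQ flip: sum_distrib_right cong: if_cong)
    have 2: "(\<Sum>k\<in>UNIV. \<Sum>m\<in>UNIV. (if j = k then X $ i $ m else 0) * (Q $ k $ a * Q $ m $ b))
        = l b * Q $ i $ b * Q $ j $ a"
    proof -
      have "(\<Sum>k\<in>UNIV. \<Sum>m\<in>UNIV. (if j = k then X $ i $ m else 0) * (Q $ k $ a * Q $ m $ b))
        = (\<Sum>m\<in>UNIV. X $ i $ m * Q $ m $ b) * Q $ j $ a"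
        by (subst sum.swap, simp only: if_zero_mult sum.delta sum.delta' finite UNIV_I if_True,
            simp only: sum_distrib_left sum_distrib_right mult_ac)
      then show ?thesis by (simp only: XQ)
    qed
    have 3: "(\<Sum>k\<in>UNIV. \<Sum>m\<in>UNIV. (if i = k then X $ m $ j else 0) * (Q $ k $ a * Q $ m $ b))
        = l b * Q $ j $ b * Q $ i $ a"
    proof -
      have "(\<Sum>k\<in>UNIV. \<Sum>m\<in>UNIV. (if i = k then X $ m $ j else 0) * (Q $ k $ a * Q $ m $ b))
        = (\<Sum>m\<in>UNIV. X $ m $ j * Q $ m $ b) * Q $ i $ a"
        by (subst sum.swap, simp only: if_zero_mult sum.delta sum.delta' finite UNIV_I if_True,
            simp only: sum_distrib_left sum_distrib_right mult_ac)
      then show ?thesis by (simp only: XQ')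
    qed
    have 4: "(\<Sum>k\<in>UNIV. \<Sum>m\<in>UNIV. (if i = m then X $ k $ j else 0) * (Q $ k $ a * Q $ m $ b))
        = l a * Q $ j $ a * Q $ i $ b"
    proof -
      have "(\<Sum>k\<in>UNIV. \<Sum>m\<in>UNIV. (if i = m then X $ k $ j else 0) * (Q $ k $ a * Q $ m $ b))
        = (\<Sum>k\<in>UNIV. X $ k $ j * Q $ k $ a) * Q $ i $ b"
        by (simp only: if_zero_mult sum.delta sum.delta' finite UNIV_I if_True,
            simp only: sum_distrib_left sum_distrib_right mult_ac)
      then show ?thesis by (simp only: XQ')
    qed
    have 5: "(\<Sum>k\<in>UNIV. \<Sum>m\<in>UNIV. (if i = k \<and> j = m then 1 else 0) * (Q $ k $ a * Q $ m $ b))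
        = Q $ i $ a * Q $ j $ b"
    proof -
      have "(if i = k \<and> j = m then 1 else 0) * (Q $ k $ a * Q $ m $ b)
        = (if j = m then (if i = k then Q $ k $ a * Q $ m $ b else 0) else 0)" for k m by simp
      then show ?thesis by (simp only: sum.delta sum.delta' finite UNIV_I if_True)
    qed
    have 6: "(\<Sum>k\<in>UNIV. \<Sum>m\<in>UNIV. (if i = m \<and> j = k then 1 else 0) * (Q $ k $ a * Q $ m $ b))
        = Q $ j $ a * Q $ i $ b"
    proof -
      have "(if i = m \<and> j = k then 1 else 0) * (Q $ k $ a * Q $ m $ b)
        = (if i = m then (if j = k then Q $ k $ a * Q $ m $ b else 0) else 0)" for k m by simp
      then show ?thesis by (simp only: sum.delta sum.delta' finite UNIV_I if_True)
    qed
    have "(skew_sylvester X ** kron_square Q) $ (i, j) $ (a, b)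
      = (l a * Q $ i $ a * Q $ j $ b - l b * Q $ i $ b * Q $ j $ a
        + l b * Q $ j $ b * Q $ i $ a - l a * Q $ j $ a * Q $ i $ b
        + Q $ i $ a * Q $ j $ b + Q $ j $ a * Q $ i $ b) / 2"
      by (simp only: matrix_matrix_mult_def sum_UNIV_prod skew_sylvester_def kron_square_def
          vec_lambda_beta Let_def prod.case fst_conv snd_conv times_divide_eq_left
          distrib_right left_diff_distrib sum.distrib sum_subtractf 1 2 3 4 5 6
          flip: sum_divide_distrib)
    also have "\<dots> = (kron_square Q ** skew_sylvester (diag_mat l)) $ (i, j) $ (a, b)"
      unfolding skew_sylvester_diag mult_swap_mat_nth
      by (simp add: kron_square_def field_simps)
    finally show ?thesis .
  qed
  then show ?thesis by (simp add: vec_eq_iff)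
qed

text \<open>In the basis of all \<open>E\<^sub>i\<^sub>j - E\<^sub>j\<^sub>i\<close> for \<open>i < j\<close> and \<open>E\<^sub>i\<^sub>j\<close> for \<open>i \<ge> j\<close>, the operator of a
  diagonal matrix is triangular.\<close>

lemma det_skew_sylvester_diag:
  fixes l :: "'n::finite \<Rightarrow> real"
  shows "det (skew_sylvester (diag_mat l)) = (\<Prod>A | card A = 2. sum l A)"
proof -
  obtain f :: "'n \<Rightarrow> nat" where f: "inj f"
    using finite_imp_inj_to_nat_seg[of "UNIV :: 'n set"] by auto
  define low where "low = (\<lambda>(a, b). f a < f b)"
  have low_swap: "low (prod.swap q) \<Longrightarrow> \<not> low q" for q by (auto simp: low_def split: prod.splits)
  have low_eq: "q = prod.swap q" if "\<not> low q" "\<not> low (prod.swap q)" for q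
    using that injD[OF f] by (cases q) (auto simp: low_def)
  have low_ne: "low q \<Longrightarrow> q \<noteq> prod.swap q" "low (prod.swap q) \<Longrightarrow> q \<noteq> prod.swap q" for q
    using low_swap by metis+
  define M where "M = skew_sylvester (diag_mat l)"
  define T :: "real^('n \<times> 'n)^('n \<times> 'n)"
    where "T = swap_mat (\<lambda>_. 1) (\<lambda>q. if low q then -1 else 0)"
  define s where "s = (\<lambda>(a, b). l a + l b)"
  have s_swap: "s (prod.swap q) = s q" for q by (cases q) (simp add: s_def)
  \<comment> \<open>For \<open>f a < f b\<close>, E_ab - E_ba is an eigenvector with value
    \<open>s\<close>; diagonal units are fixed; for \<open>f a > f b\<close>, E_ab goes to itself
    plus \<open>(1 - s) / 2\<close> times E_ba - E_ab.\<close>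
  define L where "L = swap_mat (\<lambda>q. if low q then s q else 1)
    (\<lambda>q. if low (prod.swap q) then (1 - s q) / 2 else 0)"
  have M: "M = swap_mat (\<lambda>q. (s q + 1) / 2) (\<lambda>q. (1 - s q) / 2)"
    unfolding M_def skew_sylvester_diag
    by (rule arg_cong2[of _ _ _ _ swap_mat]) (auto simp: s_def)
  have "(M ** T) $ p $ q = (T ** L) $ p $ q" for p q
  proof -
    consider "low q" "\<not> low (prod.swap q)" | "low (prod.swap q)" "\<not> low q"
      | "q = prod.swap q" "\<not> low q" "\<not> low (prod.swap q)"
      using low_swap low_eq by metis
    then show ?thesis
    proof cases
      case 1
      then show ?thesis using low_ne[of q] unfolding T_def L_def mult_swap_mat_nth
        by (auto simp: M swap_mat_nth s_swap field_simps)
    next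
      case 2
      then show ?thesis using low_ne[of q] unfolding T_def L_def mult_swap_mat_nth
        by (auto simp: M swap_mat_nth s_swap field_simps)
    next
      case 3
      then show ?thesis unfolding T_def L_def mult_swap_mat_nth
        by (auto simp: M swap_mat_nth s_swap field_simps)
    qed
  qed
  then have "M ** T = T ** L" by (simp add: vec_eq_iff)
  then have "det M * det T = det T * det L" by (metis det_mul)
  moreover have "det T = 1"
  proof -
    have "det T = (\<Prod>q\<in>UNIV. T $ q $ q)"
      by (rule det_triangular_rank[where r = "\<lambda>p. if low p then 1 else 0"])
        (use low_swap in \<open>auto simp: T_def swap_mat_nth\<close>)
    also have "\<dots> = 1"
    proof (rule prod.neutral, rule ballI)
      fix q show "T $ q $ q = 1" using low_ne(1)[of q] by (auto simp: T_def swap_mat_nth)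
    qed
    finally show ?thesis .
  qed
  ultimately have "det M = det L" by simp
  also have "det L = (\<Prod>q\<in>UNIV. L $ q $ q)"
    \<comment> \<open>The off-diagonal entries of \<open>L\<close> lie in rows with
      \<open>low\<close>, those of \<open>T\<close> in columns with \<open>low\<close>; hence the
      reversed rank.\<close>
    by (rule det_triangular_rank[where r = "\<lambda>p. if low p then 0 else 1"])
      (use low_swap in \<open>auto simp: L_def swap_mat_nth\<close>)
  also have "\<dots> = (\<Prod>q\<in>UNIV. if low q then s q else 1)"
  proof (rule prod.cong)
    fix q show "L $ q $ q = (if low q then s q else 1)"
      using low_ne(2)[of q] by (auto simp: L_def swap_mat_nth)
  qed simp
  also have "\<dots> = (\<Prod>q | low q. s q)"
    using prod.inter_filter[of UNIV s low] by simp
  also have "\<dots> = (\<Prod>(i, j) | i \<in> UNIV \<and> j \<in> UNIV \<and> f i < f j. l (id i) + l (id j))"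
    by (rule prod.cong) (auto simp: low_def s_def)
  also have "\<dots> = (\<Prod>A | card A = 2. sum l A)"
  proof (rule prod_ordered_pairs)
    show "(f i < f j) \<noteq> (f j < f i)" if "i \<noteq> j" for i j
      using injD[OF f, of i j] that by (metis less_asym linorder_neqE_nat)
  qed (use bij_id in \<open>auto simp: id_def\<close>)
  finally show ?thesis by (simp add: M_def)
qed

text \<open>\<open>kron_square Q\<close> is invertible, so the intertwining relation makes the two
  operators similar. The right side is visibly polynomial in the entries of
  \<open>X\<close>.\<close>

lemma q_poly_eq_det:
  fixes X :: "real^'n^'n"
  assumes "X \<in> sym_matrices"
  shows "q_poly X = det (skew_sylvester X)"
proof -
  obtain Q l where Q: "orthogonal_matrix Q" "X = Q ** diag_mat l ** transpose Q"
    using assms by (rule sym_matrix_diagonalization)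
  have "det (kron_square Q) * det (kron_square (transpose Q)) = 1"
    by (simp add: kron_square_orthogonal[OF Q(1)] flip: det_mul)
  then have "det (kron_square Q) \<noteq> 0" by auto
  moreover have "det (skew_sylvester X) * det (kron_square Q)
      = det (kron_square Q) * det (skew_sylvester (diag_mat l))"
    by (metis det_mul skew_sylvester_conj[OF Q])
  ultimately have "det (skew_sylvester X) = det (skew_sylvester (diag_mat l))" by simp
  then show ?thesis
    by (simp add: det_skew_sylvester_diag Q(2) q_poly_diagonalization[OF Q(1)])
qed

section \<open>Polynomiality and hyperbolicity of \<open>q\<close>\<close>

lemma real_polynomial_function_det:
  fixes M :: "'a::real_normed_vector \<Rightarrow> real^'n^'n"
  assumes "\<And>i j. real_polynomial_function (\<lambda>x. M x $ i $ j)"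
  shows "real_polynomial_function (\<lambda>x. det (M x))"
proof -
  have "real_polynomial_function (\<lambda>x. \<Prod>i\<in>UNIV. M x $ i $ p i)" for p
    using assms by (intro real_polynomial_function_prod) auto
  then have "real_polynomial_function (\<lambda>x. of_int (sign p) * (\<Prod>i\<in>UNIV. M x $ i $ p i))" for p
    by (intro real_polynomial_function.intros(2,4))
  then show ?thesis
    unfolding det_def by (intro real_polynomial_function_sum) (auto simp: finite_permutations)
qed

lemma real_polynomial_function_skew_sylvester:
  "real_polynomial_function (\<lambda>X :: real^'n^'n. skew_sylvester X $ p $ q)"
proof -
  have lin: "real_polynomial_function (\<lambda>X :: real^'n^'n. if b then X $ i $ j else 0)" for b i j
  proof (cases b)
    case True
    have "bounded_linear (\<lambda>X :: real^'n^'n. X $ i $ j)"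
      by (rule bounded_linear_compose[OF bounded_linear_vec_nth bounded_linear_vec_nth])
    with True show ?thesis by (simp add: real_polynomial_function.intros(1))
  qed (simp add: real_polynomial_function.intros(2))
  obtain i j k l where "p = (i, j)" "q = (k, l)" by (cases p, cases q)
  then show ?thesis
    unfolding skew_sylvester_def vec_lambda_beta Let_def
    by (simp only: prod.case)
      (rule real_polynomial_function_divide real_polynomial_function_diff
        real_polynomial_function.intros(2,3) lin)+
qed

lemma hyperbolic_q:
  "hyperbolic_on sym_matrices (q_poly :: real^'n^'n \<Rightarrow> real) (mat 1)"
  unfolding hyperbolic_on_def homogeneous_polynomial_on_def
proof (intro conjI exI[of _ "\<lambda>X. det (skew_sylvester X)"] exI[of _ "card {A :: 'n set. card A = 2}"]
    ballI allI impI)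
  show "real_polynomial_function (\<lambda>X :: real^'n^'n. det (skew_sylvester X))"
    by (intro real_polynomial_function_det real_polynomial_function_skew_sylvester)
next
  fix X :: "real^'n^'n" and c assume "X \<in> sym_matrices"
  then obtain Q l where Q: "orthogonal_matrix Q" "X = Q ** diag_mat l ** transpose Q"
    by (rule sym_matrix_diagonalization)
  show "q_poly (c *\<^sub>R X) = c ^ card {A :: 'n set. card A = 2} * q_poly X"
    by (simp add: Q(2) diagonalization_scaleR q_poly_diagonalization[OF Q(1)]
        prod.distrib flip: sum_distrib_left)
next
  fix X :: "real^'n^'n" and z :: complex
  assume "X \<in> sym_matrices"
  then obtain Q l where Q: "orthogonal_matrix Q" "X = Q ** diag_mat l ** transpose Q"
    by (rule sym_matrix_diagonalization)
  assume "poly (map_poly complex_of_real (line_poly q_poly (mat 1) X)) z = 0"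
  then obtain a where "z = complex_of_real a"
    unfolding Q(2) line_poly_q_root_iff[OF Q(1)] by blast
  then show "z \<in> \<real>" by simp
next
  show "mat 1 \<in> sym_matrices" by (simp add: sym_matrices_def)
next
  have Q: "orthogonal_matrix (mat 1 :: real^'n^'n)" by (rule orthogonal_matrix_id)
  have "q_poly (mat 1 :: real^'n^'n) = (\<Prod>A | card (A :: 'n set) = 2. \<Sum>i\<in>A. 1 :: real)"
    by (subst mat1_diagonalization[OF Q], rule q_poly_diagonalization[OF Q])
  then show "q_poly (mat 1 :: real^'n^'n) \<noteq> 0" by simp
next
  fix X :: "real^'n^'n" assume "X \<in> sym_matrices"
  then show "det (skew_sylvester X) = q_poly X" by (rule q_poly_eq_det[symmetric])
qed

section \<open>Compressions of diagonal matrices\<close>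

text \<open>In the Leibniz expansion, each permutation \<open>p\<close> picks up all weights except the one of the
  column \<open>p k\<close>; the weights can therefore be moved to row \<open>k\<close>.\<close>

lemma det_scale_columns_except_row:
  fixes R :: "'a::comm_ring_1^'n^'n"
  shows "det (\<chi> a i. if a = k then R $ a $ i else l i * R $ a $ i)
    = det (\<chi> a i. if a = k then (\<Prod>j\<in>-{i}. l j) * R $ a $ i else R $ a $ i)"
  unfolding det_def
proof (intro sum.cong refl arg_cong2[of _ _ _ _ "(*)"])
  fix p assume "p \<in> {p. p permutes (UNIV :: 'n set)}"
  then have p: "p permutes UNIV" by simp
  have split: "(\<Prod>a\<in>UNIV. g a) = g k * (\<Prod>a\<in>-{k}. g a)" for g :: "'n \<Rightarrow> 'a"
    by (subst prod.remove[of _ k]) (auto simp: Compl_eq_Diff_UNIV)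
  have "inj_on p (- {k})" using p by (meson inj_on_subset permutes_inj subset_UNIV)
  moreover have "p ` (- {k}) = - {p k}"
    using p by (metis bij_image_Compl_eq image_empty image_insert permutes_bij)
  ultimately have "(\<Prod>a\<in>-{k}. l (p a)) = (\<Prod>j\<in>-{p k}. l j)"
    by (metis prod.reindex_cong)
  then show "(\<Prod>a\<in>UNIV. (\<chi> a i. if a = k then R $ a $ i else l i * R $ a $ i) $ a $ p a)
    = (\<Prod>a\<in>UNIV. (\<chi> a i. if a = k then (\<Prod>j\<in>-{i}. l j) * R $ a $ i else R $ a $ i) $ a $ p a)"
    by (simp add: split prod.distrib mult_ac)
qed

text \<open>By \<open>off\<close>, the product on the left is the determinant of the compression of \<open>diag_mat l\<close> to
  the orthogonal complement of row \<open>k\<close> of \<open>R\<close>.\<close>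

lemma det_diagonal_compression:
  fixes R :: "real^'n^'n"
  assumes R: "orthogonal_matrix R"
    and off: "\<And>a b. a \<noteq> k \<Longrightarrow> b \<noteq> k \<Longrightarrow> a \<noteq> b \<Longrightarrow> (\<Sum>i\<in>UNIV. l i * R $ a $ i * R $ b $ i) = 0"
  shows "(\<Prod>a\<in>-{k}. \<Sum>i\<in>UNIV. l i * (R $ a $ i)\<^sup>2)
    = (\<Sum>i\<in>UNIV. (\<Prod>j\<in>-{i}. l j) * (R $ k $ i)\<^sup>2)"
proof -
  define w where "w i = (\<Prod>j\<in>-{i}. l j)" for i
  \<comment> \<open>\<open>det N\<close> is computed twice. Row \<open>k\<close> of \<open>N\<close>
    is a unit vector and by \<open>off\<close> the remaining block is diagonal, which gives the left
    side; moving the weights of \<open>N1\<close> into row \<open>k\<close> gives the right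
    side.\<close>
  define N1 :: "real^'n^'n" where "N1 = (\<chi> a i. if a = k then R $ a $ i else l i * R $ a $ i)"
  define N where "N = N1 ** transpose R"
  have Nk: "N $ k $ b = (if k = b then 1 else 0)" for b
    by (simp add: N_def N1_def matrix_matrix_mult_def transpose_def orthogonal_matrix_entries[OF R])
  have Na: "N $ a $ b = (\<Sum>i\<in>UNIV. l i * R $ a $ i * R $ b $ i)" if "a \<noteq> k" for a b
    using that by (simp add: N_def N1_def matrix_matrix_mult_def transpose_def)
  have "det N = (\<Prod>a\<in>UNIV. N $ a $ a)"
  proof (rule det_triangular_rank[where r = "\<lambda>a. if a = k then 1 else 0"])
    fix a b assume "a \<noteq> b" "\<not> (if a = k then 1 else 0 :: nat) < (if b = k then 1 else 0)"
    then show "N $ a $ b = 0" using off[of a b] by (cases "a = k"; cases "b = k") (auto simp: Nk Na)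
  qed
  also have "\<dots> = N $ k $ k * (\<Prod>a\<in>-{k}. N $ a $ a)"
    by (subst prod.remove[of _ k]) (auto simp: Compl_eq_Diff_UNIV)
  also have "\<dots> = (\<Prod>a\<in>-{k}. \<Sum>i\<in>UNIV. l i * (R $ a $ i)\<^sup>2)"
    by (simp add: Nk Na power2_eq_square mult.assoc)
  finally have detN: "det N = (\<Prod>a\<in>-{k}. \<Sum>i\<in>UNIV. l i * (R $ a $ i)\<^sup>2)" .
  \<comment> \<open>The coordinates of the weighted row \<open>k\<close> with respect to the
    orthonormal rows of \<open>R\<close>. Replacing row \<open>k\<close> by this combination
    multiplies \<open>det R\<close> by the coefficient \<open>x $ k\<close>, as in Cramer's
    rule.\<close>
  define x :: "real^'n" where "x = (\<chi> b. \<Sum>i\<in>UNIV. w i * R $ k $ i * R $ b $ i)"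
  have "(\<Sum>b\<in>UNIV. x $ b * R $ b $ j) = w j * R $ k $ j" for j
  proof -
    have "(\<Sum>b\<in>UNIV. x $ b * R $ b $ j)
        = (\<Sum>i\<in>UNIV. w i * R $ k $ i * (\<Sum>b\<in>UNIV. R $ b $ i * R $ b $ j))"
      by (simp add: x_def sum_distrib_left sum_distrib_right mult.assoc) (rule sum.swap)
    then show ?thesis
      by (simp add: orthogonal_matrix_entries[OF R] if_zero_mult cong: if_cong)
  qed
  then have "(\<chi> a i. if a = k then w i * R $ a $ i else R $ a $ i)
      = (\<chi> a. if a = k then \<Sum>b\<in>UNIV. x $ b *s row b R else row a R)"
    by (simp add: vec_eq_iff row_def)
  then have "det N1 = x $ k * det R"
    unfolding N1_def det_scale_columns_except_row w_def[symmetric]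
    by (simp add: cramer_lemma_transpose)
  moreover have "det R * det R = 1"
    using det_orthogonal_matrix[OF R] by auto
  ultimately have "det N = x $ k"
    by (simp add: N_def det_mul)
  then show ?thesis
    unfolding detN[symmetric] by (simp add: x_def w_def power2_eq_square mult.assoc)
qed

text \<open>Row \<open>k\<close> is the normalized all-ones vector; the other rows are orthonormal
  eigenvectors of the compression to its complement. The index \<open>k\<close> only reserves a
  place for that vector.\<close>

lemma diagonal_compression_eigenbasis:
  fixes l :: "'n::finite \<Rightarrow> real" and k :: 'n
  obtains R :: "real^'n^'n" where "orthogonal_matrix R"
    "\<And>i. R $ k $ i = 1 / sqrt (real CARD('n))"
    "\<And>a b. a \<noteq> k \<Longrightarrow> b \<noteq> k \<Longrightarrow> a \<noteq> b \<Longrightarrow> (\<Sum>i\<in>UNIV. l i * R $ a $ i * R $ b $ i) = 0"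
proof -
  define e :: "real^'n" where "e = (\<chi> i. 1 / sqrt (real CARD('n)))"
  have ee: "e \<bullet> e = 1" by (simp add: e_def inner_vec_def)
  define D :: "real^'n \<Rightarrow> real^'n" where "D x = diag_mat l *v x" for x
  \<comment> \<open>Apply \<open>D\<close>, then project onto the complement of \<open>e\<close>.
    The correction is a multiple of \<open>e\<close>, so \<open>f\<close> and \<open>D\<close> give
    the same form against vectors of \<open>S\<close>.\<close>
  define f where "f x = D x - (e \<bullet> D x) *\<^sub>R e" for x
  define S where "S = {x. e \<bullet> x = 0}"
  have D: "D x \<bullet> y = (\<Sum>i\<in>UNIV. l i * x $ i * y $ i)" for x y
    by (simp add: D_def matrix_vector_mult_def inner_vec_def if_zero_mult cong: if_cong)
  have S: "subspace S" unfolding S_def by (rule subspace_hyperplane)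
  have lin: "linear f"
    by (simp add: linear_iff f_def D_def matrix_vector_right_distrib inner_add_right
        scaleR_add_left matrix_vector_mult_scaleR scaleR_diff_right)
  have fS: "f ` S \<subseteq> S" using ee by (auto simp: f_def S_def inner_diff_right)
  have fi: "f x \<bullet> y = D x \<bullet> y" if "y \<in> S" for x y
    using that by (simp add: f_def S_def inner_diff_left)
  have sa: "f x \<bullet> y = x \<bullet> f y" if "x \<in> S" "y \<in> S" for x y
  proof -
    have "D x \<bullet> y = D y \<bullet> x" by (simp add: D mult_ac)
    then show ?thesis using fi[OF that(2), of x] fi[OF that(1), of y] by (simp add: inner_commute)
  qed
  have "e \<noteq> 0" using ee by auto
  then have "dim S = CARD('n) - 1" unfolding S_def by (simp add: dim_hyperplane)
  then obtain E where E: "E \<subseteq> S" "finite E" "card E = CARD('n) - 1" "pairwise orthogonal E"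
    "\<And>v. v \<in> E \<Longrightarrow> norm v = 1" "\<And>v. v \<in> E \<Longrightarrow> \<exists>\<mu>. f v = \<mu> *\<^sub>R v"
    using selfadjoint_orthonormal_eigenbasis[OF lin S fS sa] by auto
  have "card (- {k}) = card E" by (simp add: E(3) Compl_eq_Diff_UNIV)
  then obtain u where u: "bij_betw u (- {k}) E"
    using finite_same_card_bij[of "- {k}" E] E(2) by auto
  have uE: "u a \<in> E" if "a \<noteq> k" for a using u that by (auto simp: bij_betw_def)
  have uo: "u a \<bullet> u b = 0" if "a \<noteq> k" "b \<noteq> k" "a \<noteq> b" for a b
  proof -
    have "u a \<noteq> u b" using u that by (auto simp: bij_betw_def inj_on_def)
    then show ?thesis using E(4) uE that by (auto simp: pairwise_def orthogonal_def)
  qed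
  define R where "R = (\<chi> a. if a = k then e else u a)"
  have row: "row a R = (if a = k then e else u a)" for a
    by (simp add: R_def row_def vec_eq_iff)
  have ue: "e \<bullet> u a = 0" if "a \<noteq> k" for a using E(1) uE[OF that] by (auto simp: S_def)
  have "norm e = 1" using ee by (simp add: norm_eq_1)
  then have "orthogonal_matrix R"
    unfolding orthogonal_matrix_orthonormal_rows row
    using ue uo uE E(5) by (auto simp: orthogonal_def inner_commute)
  moreover have "R $ k $ i = 1 / sqrt (real CARD('n))" for i
    by (simp add: R_def e_def)
  moreover have "(\<Sum>i\<in>UNIV. l i * R $ a $ i * R $ b $ i) = 0" if "a \<noteq> k" "b \<noteq> k" "a \<noteq> b" for a b
  proof -
    obtain \<mu> where "f (u a) = \<mu> *\<^sub>R u a" using E(6)[OF uE[OF \<open>a \<noteq> k\<close>]] by blast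
    then have "f (u a) \<bullet> u b = 0" using uo[OF that] by simp
    then have "D (u a) \<bullet> u b = 0" using fi[of "u b" "u a"] uE[OF that(2)] E(1) by auto
    then show ?thesis using that by (simp add: D R_def)
  qed
  ultimately show ?thesis using that by blast
qed

section \<open>The determinant of \<open>\<B>(X)\<close>\<close>

lemma card_doubletons_plus:
  "card {A :: 'n::finite set. card A = 2} + CARD('n) = CARD('n) + 1 choose 2"
proof -
  have "card {A :: 'n set. card A = 2} = CARD('n) choose 2"
    using n_subsets[of "UNIV :: 'n set" 2] by simp
  then show ?thesis by (simp add: numeral_2_eq_2)
qed

section \<open>The trace form and its Gram matrix at the identity\<close>

lemma matrix_add_distrib_right:
  fixes A :: "'a::semiring_1^'n^'m" and C :: "'a^'p^'n"
  shows "(A + B) ** C = A ** C + B ** C"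
  by (simp add: vec_eq_iff matrix_matrix_mult_def sum.distrib distrib_right)

lemma bilinear_trace_sandwich:
  fixes X :: "real^'n^'n"
  shows "bilinear (\<lambda>(A :: real^'n^'n) B. trace (A ** X ** B))"
proof -
  have tr: "trace (c *\<^sub>R A) = c * trace A" for c and A :: "real^'n^'n"
    by (simp add: trace_def sum_distrib_left)
  then show ?thesis
    by (simp add: bilinear_def linear_iff matrix_add_distrib_right matrix_add_ldistrib trace_add
        tr matrix_scalar_ac flip: scalar_matrix_assoc)
qed

lemma inner_eq_trace:
  fixes A B :: "real^'n^'n"
  assumes "B \<in> sym_matrices"
  shows "A \<bullet> B = trace (A ** B)"
proof -
  have "B $ i $ j = B $ j $ i" for i j
    using assms by (simp add: sym_matrices_def vec_eq_iff transpose_def)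
  then show ?thesis
    by (simp add: inner_vec_def trace_def matrix_matrix_mult_def)
qed

lemma subspace_sym_matrices: "subspace sym_matrices"
  by (simp add: subspace_def sym_matrices_def vec_eq_iff transpose_def)

lemma B_matrix_sym:
  fixes B :: "'d::finite \<Rightarrow> real^'n^'n"
  assumes "\<And>i. B i \<in> sym_matrices" "X \<in> sym_matrices"
  shows "B_matrix B X \<in> sym_matrices"
proof -
  have "trace (B i ** X ** B j) = trace (B j ** X ** B i)" for i j
  proof -
    have "trace (B i ** X ** B j) = trace (transpose (B i ** X ** B j))"
      by (simp add: trace_def transpose_def)
    also have "\<dots> = trace (B j ** X ** B i)"
      using assms by (simp add: matrix_transpose_mul sym_matrices_def matrix_mul_assoc)
    finally show ?thesis .
  qed
  then show ?thesis by (simp add: B_matrix_def sym_matrices_def vec_eq_iff transpose_def)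
qed

text \<open>At the identity the trace form is the inner product on symmetric matrices, so the
  quadratic form at \<open>v\<close> is the squared norm of the combination of the
  \<open>B i\<close> with coefficients \<open>v\<close>.\<close>

lemma B_matrix_mat1_positive_definite:
  fixes B :: "'d::finite \<Rightarrow> real^'n^'n"
  assumes B: "indexed_basis_of B trace_free_sym_matrices"
  shows "positive_definite (B_matrix B (mat 1))"
  unfolding positive_definite_def
proof (intro conjI allI impI)
  have Bi: "B i \<in> trace_free_sym_matrices" for i
    using B span_base[of "B i" "range B"] by (auto simp: indexed_basis_of_def)
  then show "B_matrix B (mat 1) \<in> sym_matrices"
    by (intro B_matrix_sym) (auto simp: trace_free_sym_matrices_def sym_matrices_def)
  fix v :: "real^'d" assume v: "v \<noteq> 0"
  define A where "A = (\<Sum>i\<in>UNIV. v $ i *\<^sub>R B i)"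
  have inj: "inj B" and ind: "independent (range B)"
    using B by (auto simp: indexed_basis_of_def)
  have "A \<in> sym_matrices"
    using Bi unfolding A_def trace_free_sym_matrices_def
    by (intro subspace_sum subspace_scale subspace_sym_matrices) auto
  have "A \<noteq> 0"
  proof
    assume "A = 0"
    have "(\<Sum>b\<in>range B. v $ inv B b *\<^sub>R b) = A"
      by (simp add: sum.reindex[OF inj] A_def inv_f_f[OF inj])
    then have "v $ inv B (B i) = 0" for i
      using independentD[OF ind, of "range B" "\<lambda>b. v $ inv B b" "B i"] \<open>A = 0\<close> by simp
    then show False using v by (simp add: inv_f_f[OF inj] vec_eq_iff)
  qed
  then have "0 < A \<bullet> A" by simp
  also have "A \<bullet> A = trace (A ** mat 1 ** A)"
    using inner_eq_trace[OF \<open>A \<in> sym_matrices\<close>] by simp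
  also have "\<dots> = (\<Sum>(i, j)\<in>UNIV \<times> UNIV. trace (v $ i *\<^sub>R B i ** mat 1 ** v $ j *\<^sub>R B j))"
    unfolding A_def by (rule bilinear_sum[OF bilinear_trace_sandwich])
  also have "\<dots> = (\<Sum>i\<in>UNIV. \<Sum>j\<in>UNIV. v $ i * v $ j * trace (B i ** mat 1 ** B j))"
    using bilinear_lmul[OF bilinear_trace_sandwich[of "mat 1 :: real^'n^'n"]]
      bilinear_rmul[OF bilinear_trace_sandwich[of "mat 1 :: real^'n^'n"]]
    by (auto simp: sum.cartesian_product intro!: sum.cong)
  also have "\<dots> = v \<bullet> (B_matrix B (mat 1) *v v)"
    by (simp add: inner_vec_def matrix_vector_mult_def B_matrix_def sum_distrib_left mult_ac)
  finally show "0 < v \<bullet> (B_matrix B (mat 1) *v v)" .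
qed

lemma det_B_matrix_mat1_nonzero:
  fixes B :: "'d::finite \<Rightarrow> real^'n^'n"
  assumes "indexed_basis_of B trace_free_sym_matrices"
  shows "det (B_matrix B (mat 1)) \<noteq> 0"
proof
  let ?G = "B_matrix B (mat 1)"
  assume "det ?G = 0"
  then have "\<not> invertible ?G" by (simp add: invertible_det_nz)
  then obtain v where "v \<noteq> 0" "?G *v v = 0"
    using matrix_left_invertible_ker[of ?G] by (auto simp: invertible_left_inverse)
  then show False
    using B_matrix_mat1_positive_definite[OF assms] by (auto simp: positive_definite_def)
qed

text \<open>An eigenbasis of the form \<open>(A, B) \<mapsto> tr (A D B)\<close> for the diagonal matrix \<open>D\<close>: off-diagonal
  symmetric matrix units, and diagonal matrices whose entries are the rows of \<open>R\<close>.\<close>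

definition eigen_matrix :: "real^'n^'n \<Rightarrow> 'n \<times> 'n \<Rightarrow> real^'n^'n" where
  "eigen_matrix R p = (let (a, b) = p in \<chi> x y.
     if a = b then (if x = y then R $ a $ x else 0)
     else (if {x, y} = {a, b} then 1 / sqrt 2 else 0))"

lemma eigen_matrix_sym: "eigen_matrix R p $ x $ y = eigen_matrix R p $ y $ x"
  by (auto simp: eigen_matrix_def insert_commute split: prod.split)

lemma eigen_matrix_form_diag_diag:
  "(\<Sum>x\<in>UNIV. \<Sum>y\<in>UNIV. eigen_matrix R (a, a) $ x $ y * l y * eigen_matrix R (b, b) $ x $ y)
    = (\<Sum>x\<in>UNIV. l x * R $ a $ x * R $ b $ x)"
  by (simp add: eigen_matrix_def if_zero_mult mult_ac cong: if_cong)

text \<open>The squared entries \<open>1 / sqrt 2\<close> leave half of \<open>l b\<close> from row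
  \<open>a\<close> and half of \<open>l a\<close> from row \<open>b\<close>.\<close>

lemma eigen_matrix_form_off_diag:
  assumes "a \<noteq> b"
  shows "(\<Sum>x\<in>UNIV. \<Sum>y\<in>UNIV. eigen_matrix R (a, b) $ x $ y * l y * eigen_matrix R (a, b) $ x $ y)
    = (l a + l b) / 2"
proof -
  have "(\<Sum>y\<in>UNIV. eigen_matrix R (a, b) $ x $ y * l y * eigen_matrix R (a, b) $ x $ y)
      = (if x = a then l b / 2 else 0) + (if x = b then l a / 2 else 0)" for x
  proof -
    have "eigen_matrix R (a, b) $ x $ y * l y * eigen_matrix R (a, b) $ x $ y
        = (if y = b then (if x = a then l y / 2 else 0) else 0)
          + (if y = a then (if x = b then l y / 2 else 0) else 0)" for y
      using assms by (auto simp: eigen_matrix_def doubleton_eq_iff)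
    then show ?thesis by (simp add: sum.distrib)
  qed
  then show ?thesis by (simp add: sum.distrib field_simps)
qed

text \<open>The supports are disjoint; the second hypothesis excludes two diagonal matrices, whose
  supports may overlap.\<close>

lemma eigen_matrix_form_disjoint:
  assumes "{a, b} \<noteq> {c, d}" "a \<noteq> b \<or> c \<noteq> d"
  shows "(\<Sum>x\<in>UNIV. \<Sum>y\<in>UNIV. eigen_matrix R (a, b) $ x $ y * l y * eigen_matrix R (c, d) $ x $ y) = 0"
proof -
  have "eigen_matrix R (a, b) $ x $ y * l y * eigen_matrix R (c, d) $ x $ y = 0" for x y
    using assms by (auto simp: eigen_matrix_def doubleton_eq_iff)
  then show ?thesis by (intro sum.neutral ballI)
qed

lemma trace_conjugation:
  fixes Q A :: "real^'n^'n"
  assumes "orthogonal_matrix Q"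
  shows "trace (Q ** A ** transpose Q) = trace A"
proof -
  have "trace (Q ** A ** transpose Q) = trace (transpose Q ** (Q ** A))"
    by (rule trace_mul_sym)
  also have "\<dots> = trace (transpose Q ** Q ** A)" by (simp only: matrix_mul_assoc)
  finally show ?thesis using assms by (simp add: orthogonal_matrix_def)
qed

lemma conjugation_mult:
  fixes Q A B :: "real^'n^'n"
  assumes "orthogonal_matrix Q"
  shows "(Q ** A ** transpose Q) ** (Q ** B ** transpose Q) = Q ** (A ** B) ** transpose Q"
proof -
  have "(Q ** A ** transpose Q) ** (Q ** B ** transpose Q)
      = Q ** A ** (transpose Q ** Q) ** B ** transpose Q"
    by (simp only: matrix_mul_assoc)
  also have "\<dots> = Q ** A ** B ** transpose Q"
    using assms by (simp only: orthogonal_matrix_def matrix_mul_rid)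
  finally show ?thesis by (simp only: matrix_mul_assoc)
qed

text \<open>The adapted basis, and with it the transition matrix \<open>S\<close>, depends on
  \<open>X\<close>. But the same basis is orthonormal for the form at the identity, so
  \<open>(det S)\<^sup>2\<close> is the Gram determinant there, which does not depend on
  \<open>X\<close>.\<close>

lemma det_B_matrix:
  fixes B :: "'d::finite \<Rightarrow> real^'n^'n"
  assumes d: "CARD('d) = (CARD('n) + 1 choose 2) - 1"
    and B: "indexed_basis_of B trace_free_sym_matrices"
    and X: "X \<in> sym_matrices"
  shows "0 \<le> det (B_matrix B (mat 1))"
    and "det (B_matrix B X) = det (B_matrix B (mat 1))
      / (2 ^ card {A :: 'n set. card A = 2} * real CARD('n)) * (q_poly X * elem_sym (CARD('n) - 1) X)"
proof -
  obtain Q l where Q: "orthogonal_matrix Q" and XQ: "X = Q ** diag_mat l ** transpose Q"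
    using X by (rule sym_matrix_diagonalization)
  obtain f :: "'n \<Rightarrow> nat" where f: "inj f"
    using finite_imp_inj_to_nat_seg[of "UNIV :: 'n set"] by auto
  \<comment> \<open>An arbitrary index, reserved for the constant row of \<open>R\<close>; that row
    would give a multiple of the identity, which is not trace-free.\<close>
  define k0 :: 'n where "k0 = undefined"
  obtain R :: "real^'n^'n" where R: "orthogonal_matrix R"
    and Rk: "\<And>i. R $ k0 $ i = 1 / sqrt (real CARD('n))"
    and off: "\<And>a b. a \<noteq> k0 \<Longrightarrow> b \<noteq> k0 \<Longrightarrow> a \<noteq> b \<Longrightarrow> (\<Sum>i\<in>UNIV. l i * R $ a $ i * R $ b $ i) = 0"
    using diagonal_compression_eigenbasis[of k0 l] by blast
  define low where "low = {(a, b). f a < f b}"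
  define K where "K = low \<union> (\<lambda>a. (a, a)) ` (- {k0})"
  define N where "N = card {A :: 'n set. card A = 2}"

  have flt: "f i < f j \<or> f j < f i" if "i \<noteq> j" for i j
    using that injD[OF f, of i j] by linarith
  have bij: "bij_betw (\<lambda>(i, j). {id i, id j}) {(i, j). i \<in> UNIV \<and> j \<in> UNIV \<and> f i < f j} {A. card A = 2}"
    by (rule bij_betw_doubletons[OF bij_id]) (use flt in auto)
  have card_low: "card low = N"
    using bij_betw_same_card[OF bij] by (simp add: low_def N_def)
  have disj: "low \<inter> (\<lambda>a. (a, a)) ` (- {k0}) = {}" by (auto simp: low_def)
  have "card ((\<lambda>a. (a, a)) ` (- {k0})) = CARD('n) - 1"
    by (subst card_image) (auto simp: inj_on_def Compl_eq_Diff_UNIV)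
  then have "card K = N + (CARD('n) - 1)"
    unfolding K_def by (subst card_Un_disjoint[OF _ _ disj]) (auto simp: card_low)
  moreover have "CARD('n) \<ge> 1" by (simp add: Suc_leI)
  ultimately have cardK: "card K = CARD('d)"
    unfolding d card_doubletons_plus[where 'n = 'n, symmetric] N_def by simp

  define C where "C p = Q ** eigen_matrix R p ** transpose Q" for p
  define m where "m w p = (if fst p \<noteq> snd p then (w (fst p) + w (snd p)) / 2
    else \<Sum>x\<in>UNIV. w x * (R $ fst p $ x)\<^sup>2)" for w :: "'n \<Rightarrow> real" and p :: "'n \<times> 'n"

  \<comment> \<open>The weights stay general because the form is needed for \<open>l\<close> and for
    the constant 1. The assumption on \<open>w\<close> handles distinct diagonal indices, the only
    distinct members of \<open>K\<close> whose supports can overlap.\<close>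
  have form: "trace (C p ** (Q ** diag_mat w ** transpose Q) ** C q) = (if p = q then m w p else 0)"
    if w: "\<And>a b. a \<noteq> k0 \<Longrightarrow> b \<noteq> k0 \<Longrightarrow> a \<noteq> b \<Longrightarrow> (\<Sum>i\<in>UNIV. w i * R $ a $ i * R $ b $ i) = 0"
      and pq: "p \<in> K" "q \<in> K" for w p q
  proof -
    obtain a b c e where p: "p = (a, b)" and q: "q = (c, e)" by (cases p, cases q)
    have "trace (C p ** (Q ** diag_mat w ** transpose Q) ** C q)
        = trace (eigen_matrix R p ** diag_mat w ** eigen_matrix R q)"
      unfolding C_def conjugation_mult[OF Q] by (rule trace_conjugation[OF Q])
    also have "\<dots> = (\<Sum>x\<in>UNIV. \<Sum>y\<in>UNIV. eigen_matrix R p $ x $ y * w y * eigen_matrix R q $ y $ x)"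
      by (simp only: trace_def matrix_matrix_mult_def[of "_ ** _"] vec_lambda_beta matrix_mult_diag_mat_nth)
    also have "\<dots> = (\<Sum>x\<in>UNIV. \<Sum>y\<in>UNIV. eigen_matrix R p $ x $ y * w y * eigen_matrix R q $ x $ y)"
      by (intro sum.cong refl arg_cong2[of _ _ _ _ "(*)"] eigen_matrix_sym)
    also have "\<dots> = (if p = q then m w p else 0)"
    proof -
      consider "a = b" "c = e" "a = c" | "a = b" "c = e" "a \<noteq> c"
        | "a \<noteq> b \<or> c \<noteq> e" "{a, b} = {c, e}" | "a \<noteq> b \<or> c \<noteq> e" "{a, b} \<noteq> {c, e}" by blast
      then show ?thesis
      proof cases
        case 1
        then show ?thesis
          by (simp add: p q eigen_matrix_form_diag_diag m_def) (simp add: power2_eq_square mult.assoc)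
      next
        case 2
        then have "a \<noteq> k0" "c \<noteq> k0" using pq by (auto simp: p q K_def low_def)
        then show ?thesis using 2 w[of a c] by (simp add: p q eigen_matrix_form_diag_diag)
      next
        case 3
        then have "a \<noteq> b" "c \<noteq> e" by auto
        \<comment> \<open>\<open>K\<close> contains each pair in one orientation only, so equal sets
          force equal indices.\<close>
        then have "f a < f b" "f c < f e" using pq by (auto simp: p q K_def low_def)
        then have "a = c" "b = e" using 3 by (auto simp: doubleton_eq_iff)
        then show ?thesis using \<open>a \<noteq> b\<close> by (simp add: p q eigen_matrix_form_off_diag m_def)
      next
        case 4
        then have "p \<noteq> q" by (auto simp: p q)
        then show ?thesis unfolding p q eigen_matrix_form_disjoint[OF 4(2,1)] by auto
      qed
    qed
    finally show ?thesis .
  qed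
  have off1: "(\<Sum>i\<in>UNIV. 1 * R $ a $ i * R $ b $ i) = 0" if "a \<noteq> b" for a b
    using that by (simp add: orthogonal_matrix_entries[OF R])
  have m1: "m (\<lambda>_. 1) p = 1" for p
    by (simp add: m_def power2_eq_square orthogonal_matrix_entries(1)[OF R])

  have eig_sym: "transpose (eigen_matrix R p) = eigen_matrix R p" for p
    by (simp add: vec_eq_iff transpose_def eigen_matrix_sym[of R p])
  have Csym: "C p \<in> sym_matrices" for p
    by (simp add: sym_matrices_def C_def matrix_transpose_mul eig_sym matrix_mul_assoc)
  have CW: "C p \<in> trace_free_sym_matrices" if "p \<in> K" for p
  proof -
    obtain a b where p: "p = (a, b)" by (cases p)
    have "trace (eigen_matrix R p) = 0"
    proof (cases "a = b")
      case True
      then have "a \<noteq> k0" using that by (auto simp: p K_def low_def)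
      \<comment> \<open>Row \<open>k0\<close> is constant, so orthogonality to it says that row
        \<open>a\<close> sums to zero, and that sum is the trace.\<close>
      then have "(\<Sum>x\<in>UNIV. R $ a $ x * R $ k0 $ x) = 0"
        using orthogonal_matrix_entries(1)[OF R, of a k0] by simp
      then have "(\<Sum>x\<in>UNIV. R $ a $ x) = 0"
        by (simp add: Rk flip: sum_divide_distrib)
      then show ?thesis using True by (simp add: p trace_def eigen_matrix_def)
    next
      case False
      then have "eigen_matrix R p $ x $ x = 0" for x by (auto simp: p eigen_matrix_def)
      then show ?thesis by (simp add: trace_def)
    qed
    then show ?thesis
      using Csym by (simp add: trace_free_sym_matrices_def C_def trace_conjugation[OF Q])
  qed
  have CC: "C p \<bullet> C q = (if p = q then 1 else 0)" if "p \<in> K" "q \<in> K" for p q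
  proof -
    have "C p \<bullet> C q = trace (C p ** mat 1 ** C q)"
      by (simp add: inner_eq_trace[OF Csym])
    also have "\<dots> = (if p = q then m (\<lambda>_. 1) p else 0)"
      unfolding mat1_diagonalization[OF Q] by (rule form) (use off1 that in auto)
    finally show ?thesis by (simp add: m1)
  qed

  obtain \<phi> where \<phi>: "bij_betw \<phi> (UNIV :: 'd set) K"
    using finite_same_card_bij[of "UNIV :: 'd set" K] cardK by auto
  have \<phi>K: "\<phi> i \<in> K" for i using \<phi> by (auto simp: bij_betw_def)
  have \<phi>eq: "\<phi> i = \<phi> j \<longleftrightarrow> i = j" for i j using \<phi> by (auto simp: bij_betw_def inj_on_def)
  define c where "c i = C (\<phi> i)" for i
  have cc: "c i \<bullet> c j = (if i = j then 1 else 0)" for i j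
    using CC[OF \<phi>K \<phi>K] by (simp add: c_def \<phi>eq)
  have injc: "inj c"
  proof (rule injI)
    fix i j assume "c i = c j"
    then show "i = j" using cc[of i i] cc[of i j] by (auto split: if_splits)
  qed
  have orth: "pairwise orthogonal (range c)"
    using cc by (auto simp: pairwise_def orthogonal_def)
  have norm: "norm (c i) = 1" for i using cc[of i i] by (simp add: norm_eq_1)
  have "0 \<notin> range c" using norm by (metis imageE norm_zero zero_neq_one)
  then have "independent (range c)" using orth pairwise_orthogonal_independent by blast
  moreover have "card (range c) = dim (trace_free_sym_matrices :: (real^'n^'n) set)"
  proof -
    have "dim (trace_free_sym_matrices :: (real^'n^'n) set) = card (range B)"
      using B dim_span_eq_card_independent[of "range B"] by (simp add: indexed_basis_of_def)
    then show ?thesis using B injc by (simp add: card_image indexed_basis_of_def)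
  qed
  moreover have "range c \<subseteq> trace_free_sym_matrices" using CW[OF \<phi>K] by (auto simp: c_def)
  ultimately have span: "trace_free_sym_matrices \<subseteq> span (range c)"
    using card_eq_dim[of "range c" trace_free_sym_matrices] by simp
  \<comment> \<open>Coefficients of the given basis in the orthonormal basis \<open>c\<close>; in
    these coordinates the Gram matrix is \<open>S\<close> times a diagonal matrix times
    \<open>transpose S\<close>.\<close>
  define S :: "real^'d^'d" where "S = (\<chi> i j. B i \<bullet> c j)"
  have expand: "B i = (\<Sum>j\<in>UNIV. S $ i $ j *\<^sub>R c j)" for i
  proof -
    have "B i \<in> trace_free_sym_matrices"
      using B span_base[of "B i" "range B"] by (auto simp: indexed_basis_of_def)
    then have "(\<Sum>v\<in>range c. (B i \<bullet> v) *\<^sub>R v) = B i"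
      using span norm by (intro orthonormal_basis_expand[OF orth]) auto
    then show ?thesis by (simp add: sum.reindex[OF injc] S_def)
  qed

  have det: "det (B_matrix B (Q ** diag_mat w ** transpose Q)) = (det S)\<^sup>2 * (\<Prod>p\<in>K. m w p)"
    if w: "\<And>a b. a \<noteq> k0 \<Longrightarrow> b \<noteq> k0 \<Longrightarrow> a \<noteq> b \<Longrightarrow> (\<Sum>i\<in>UNIV. w i * R $ a $ i * R $ b $ i) = 0"
    for w
  proof -
    let ?X = "Q ** diag_mat w ** transpose Q"
    have "B_matrix B ?X $ i $ j = (S ** diag_mat (\<lambda>k. m w (\<phi> k)) ** transpose S) $ i $ j" for i j
    proof -
      have "B_matrix B ?X $ i $ j
          = trace ((\<Sum>k\<in>UNIV. S $ i $ k *\<^sub>R c k) ** ?X ** (\<Sum>k\<in>UNIV. S $ j $ k *\<^sub>R c k))"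
        unfolding B_matrix_def vec_lambda_beta by (simp only: expand[symmetric])
      also have "\<dots> = (\<Sum>(k, k')\<in>UNIV \<times> UNIV.
          trace ((S $ i $ k *\<^sub>R c k) ** ?X ** (S $ j $ k' *\<^sub>R c k')))"
        by (rule bilinear_sum[OF bilinear_trace_sandwich])
      also have "\<dots> = (\<Sum>k\<in>UNIV. \<Sum>k'\<in>UNIV. S $ j $ k' * (S $ i $ k * trace (c k ** ?X ** c k')))"
        by (simp only: sum.cartesian_product bilinear_lmul[OF bilinear_trace_sandwich]
            bilinear_rmul[OF bilinear_trace_sandwich] real_scaleR_def)
      also have "\<dots> = (\<Sum>k\<in>UNIV. S $ j $ k * (S $ i $ k * m w (\<phi> k)))"
        by (simp add: c_def form[OF w \<phi>K \<phi>K] \<phi>eq if_zero_mult cong: if_cong)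
      also have "\<dots> = (S ** diag_mat (\<lambda>k. m w (\<phi> k)) ** transpose S) $ i $ j"
        by (simp add: matrix_matrix_mult_def[of "_ ** _"] matrix_mult_diag_mat_nth transpose_def mult_ac)
      finally show ?thesis .
    qed
    then have "B_matrix B ?X = S ** diag_mat (\<lambda>k. m w (\<phi> k)) ** transpose S"
      by (simp add: vec_eq_iff)
    moreover have "det (diag_mat (\<lambda>k. m w (\<phi> k))) = (\<Prod>k\<in>UNIV. m w (\<phi> k))"
      by (simp add: det_diagonal)
    moreover have "(\<Prod>k\<in>UNIV. m w (\<phi> k)) = (\<Prod>p\<in>K. m w p)"
      by (rule prod.reindex_bij_betw[OF \<phi>])
    ultimately show ?thesis by (simp add: det_mul power2_eq_square)
  qed
  have G: "det (B_matrix B (mat 1)) = (det S)\<^sup>2"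
  proof -
    have "det (B_matrix B (mat 1)) = (det S)\<^sup>2 * (\<Prod>p\<in>K. m (\<lambda>_. 1) p)"
      unfolding mat1_diagonalization[OF Q] by (rule det) (use off1 in auto)
    then show ?thesis by (simp add: m1)
  qed
  then show "0 \<le> det (B_matrix B (mat 1))" by simp

  \<comment> \<open>The off-diagonal indices yield \<open>q\<close> with one factor 1/2 per pair;
    the diagonal ones yield the compression determinant, where every squared entry of row
    \<open>k0\<close> is 1/n.\<close>
  have "(\<Prod>p\<in>K. m l p) = (\<Prod>p\<in>low. m l p) * (\<Prod>p\<in>(\<lambda>a. (a, a)) ` (- {k0}). m l p)"
    unfolding K_def by (rule prod.union_disjoint[OF _ _ disj]) auto
  also have "(\<Prod>p\<in>low. m l p) = (\<Prod>p\<in>low. (case p of (i, j) \<Rightarrow> l (id i) + l (id j)) / 2)"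
    by (rule prod.cong) (auto simp: low_def m_def)
  also have "\<dots> = (\<Prod>(i, j)\<in>low. l (id i) + l (id j)) / 2 ^ N"
    by (simp add: prod_dividef card_low)
  also have "(\<Prod>(i, j)\<in>low. l (id i) + l (id j)) = (\<Prod>A | card A = 2. sum l A)"
  proof -
    have "(\<Prod>(i, j) | i \<in> UNIV \<and> j \<in> UNIV \<and> f i < f j. l (id i) + l (id j))
        = (\<Prod>A | card A = 2. sum l A)"
      by (rule prod_ordered_pairs[OF bij_id]) (use flt in auto)
    then show ?thesis by (simp add: low_def)
  qed
  also have "\<dots> = q_poly X" by (simp add: XQ q_poly_diagonalization[OF Q])
  also have "(\<Prod>p\<in>(\<lambda>a. (a, a)) ` (- {k0}). m l p)
      = (\<Prod>a\<in>-{k0}. \<Sum>x\<in>UNIV. l x * (R $ a $ x)\<^sup>2)"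
    by (subst prod.reindex) (auto simp: inj_on_def m_def)
  also have "\<dots> = (\<Sum>i\<in>UNIV. (\<Prod>j\<in>-{i}. l j) * (R $ k0 $ i)\<^sup>2)"
    by (rule det_diagonal_compression[OF R off])
  also have "\<dots> = elem_sym (CARD('n) - 1) X / real CARD('n)"
    by (simp add: Rk XQ elem_sym_pred_diagonalization[OF Q] power_divide sum_divide_distrib del: One_nat_def)
  finally have "(\<Prod>p\<in>K. m l p) = q_poly X / 2 ^ N * (elem_sym (CARD('n) - 1) X / real CARD('n))" .
  then show "det (B_matrix B X) = det (B_matrix B (mat 1))
      / (2 ^ card {A :: 'n set. card A = 2} * real CARD('n)) * (q_poly X * elem_sym (CARD('n) - 1) X)"
    using det[of l, OF off] by (simp add: G N_def flip: XQ)
qed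

section \<open>Hyperbolicity, cone and determinantal representation combined\<close>

theorem theorem3:
  fixes B :: "'d::finite \<Rightarrow> real^'n^'n"
  assumes "CARD('n) \<ge> 2"
    and "CARD('d) = (CARD('n) + 1 choose 2) - 1"
    and "indexed_basis_of B trace_free_sym_matrices"
  shows "\<exists>c::real. c > 0 \<and>
    hyperbolic_on sym_matrices (q_poly :: real^'n^'n \<Rightarrow> real) (mat 1) \<and>
    hyperbolicity_cone sym_matrices (q_poly :: real^'n^'n \<Rightarrow> real) (mat 1) =
      {X \<in> sym_matrices. \<forall>i j. 1 \<le> i \<and> i < j \<and> j \<le> CARD('n) \<longrightarrow> eigval X i + eigval X j \<ge> 0} \<and>
    (psd_derivative_cone :: (real^'n^'n) set) \<subseteq>
      hyperbolicity_cone sym_matrices q_poly (mat 1) \<and>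
    definite_determinantal_representation_on sym_matrices
      (\<lambda>X. c * (q_poly X * elem_sym (CARD('n) - 1) X)) (B_matrix B)"
proof (intro exI conjI)
  \<comment> \<open>This value is forced by \<open>X = mat 1\<close>, where \<open>q\<close> is 2 to
    the number of pairs and the elementary symmetric polynomial is n.\<close>
  let ?c = "det (B_matrix B (mat 1)) / (2 ^ card {A :: 'n set. card A = 2} * real CARD('n))"
  note basis = assms(3)
  have mat1: "(mat 1 :: real^'n^'n) \<in> sym_matrices" by (simp add: sym_matrices_def)
  show "0 < ?c"
    using det_B_matrix(1)[OF assms(2) basis mat1] det_B_matrix_mat1_nonzero[OF basis]
    by (simp add: less_le)
  show "hyperbolic_on sym_matrices (q_poly :: real^'n^'n \<Rightarrow> real) (mat 1)"
    by (rule hyperbolic_q)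
  show "hyperbolicity_cone sym_matrices (q_poly :: real^'n^'n \<Rightarrow> real) (mat 1) =
      {X \<in> sym_matrices. \<forall>i j. 1 \<le> i \<and> i < j \<and> j \<le> CARD('n) \<longrightarrow> eigval X i + eigval X j \<ge> 0}"
    by (rule hyperbolicity_cone_q)
  show "(psd_derivative_cone :: (real^'n^'n) set) \<subseteq> hyperbolicity_cone sym_matrices q_poly (mat 1)"
    by (rule psd_derivative_cone_subset)
  have Bsym: "B i \<in> sym_matrices" for i
    using basis span_base[of "B i" "range B"]
    by (auto simp: indexed_basis_of_def trace_free_sym_matrices_def)
  have linear: "B_matrix B (a *\<^sub>R X + b *\<^sub>R Y) = a *\<^sub>R B_matrix B X + b *\<^sub>R B_matrix B Y" for a b X Y
    by (simp add: B_matrix_def vec_eq_iff trace_def matrix_matrix_mult_def sum.distrib sum_distrib_left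
        sum_distrib_right algebra_simps)
  show "definite_determinantal_representation_on sym_matrices
      (\<lambda>X. ?c * (q_poly X * elem_sym (CARD('n) - 1) X)) (B_matrix B)"
    unfolding definite_determinantal_representation_on_def
  proof (intro conjI ballI allI)
    show "\<exists>e\<in>sym_matrices. positive_definite (B_matrix B e)"
      using mat1 B_matrix_mat1_positive_definite[OF basis] by blast
  qed (simp_all only: linear B_matrix_sym[OF Bsym] det_B_matrix(2)[OF assms(2) basis])
qed

end
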